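(* Let $l,m\ge 1$ be integers and suppose there is a triangulation $T_0$ of $I^l\times\Delta^{m-1}$ with weighted efficiency $\bar\rho$. Then for every $\epsilon>0$ and every positive integer $n$ bigger than $lm\bar\rho/\epsilon$, $${\rho_{n+l-1}}^{\,n+l-1}\;\le\;{\rho_{n-1}}^{\,n-1}\,(\bar\rho+\epsilon)^l .$$ As a consequence, $$\lim_{i\to\infty}\rho_i\le\bar\rho .$$
   Context: A triangulation of a $d$-dimensional polytope is a decomposition of it into $d$-simplices that use as vertices only vertices of the polytope and that intersect face to face. The size $|T|$ of a triangulation is its number of $d$-simplices. For the cube $I^d=[0,1]^d$, $\phi_d$ denotes the smallest size of a triangulation of $I^d$ and $\rho_d=(\phi_d/d!)^{1/d}$ for $d\ge 1$; thus ${\rho_d}^d=\phi_d/d!$, and for $d=0$ the expression ${\rho_d}^{d}$ is read as $1$. The sequence $(\rho_i)_{i\ge1}$ converges. $\Delta^{m-1}$ denotes an $(m-1)$-simplex with vertices $v_1,\dots,v_m$. Simplices are identified with their vertex sets. An $(l+m-1)$-dimensional simplex $\tau$ with vertices among the vertices of $I^l\times\Delta^{m-1}$ decomposes as $\tau=\tau_1\cup\dots\cup\tau_m$ with $\tau_i\subset I^l\times\{v_i\}$; its type is $(t_1,\dots,t_m)=(|\tau_1|-1,\dots,|\tau_m|-1)$ and its weight is $\operatorname{weight}(\tau)=\frac{1}{\prod_{i=1}^m t_i!}$. The weighted efficiency of a triangulation $T$ of $I^l\times\Delta^{m-1}$ is $$\sqrt[l]{\frac{\sum_{\tau\in T}\operatorname{weight}(\tau)}{m^l}},$$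 the sum being over the full-dimensional simplices of $T$. *)

theory Defs
  imports "HOL-Analysis.Analysis" "HOL-Analysis.Finite_Function_Topology"
begin

text \<open>
  Simplices are represented by their vertex sets, so \<open>T\<close> is a set of vertex sets, and \<open>card T\<close> is
  the size of the triangulation. The dimension \<open>d\<close> of \<open>P\<close> is an explicit parameter
  because \<open>aff_dim\<close> and \<open>simplex\<close> are only available for Euclidean spaces, while the cubes
  of all dimensions below live in one infinite-dimensional space. Note that the empty set is a face.
\<close>

definition triangulates :: "nat \<Rightarrow> 'a::real_vector set set \<Rightarrow> 'a set \<Rightarrow> bool" where
  "triangulates d T P \<longleftrightarrow>
     finite T \<and>
     (\<forall>\<tau>\<in>T. \<tau> \<subseteq> {x. x extreme_point_of P} \<and> \<not> affine_dependent \<tau> \<and> card \<tau> = d + 1) \<and>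
     (\<Union>\<tau>\<in>T. convex hull \<tau>) = P \<and>
     (\<forall>\<sigma>\<in>T. \<forall>\<tau>\<in>T. (convex hull \<sigma> \<inter> convex hull \<tau>) face_of (convex hull \<sigma>) \<and>
                  (convex hull \<sigma> \<inter> convex hull \<tau>) face_of (convex hull \<tau>))"

text \<open>
  \<open>[0,1]\<^sup>d\<close>, with \<open>\<real>\<^sup>d\<close> realised as the finitely supported sequences that vanish outside the
  coordinates \<open>0, \<dots>, d - 1\<close>; this keeps \<open>d\<close> a term rather than a type.
\<close>

definition unit_cube :: "nat \<Rightarrow> (nat \<Rightarrow>\<^sub>0 real) set" where
  "unit_cube d =
     {x. (\<forall>i<d. 0 \<le> Poly_Mapping.lookup x i \<and> Poly_Mapping.lookup x i \<le> 1) \<and>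
         (\<forall>i\<ge>d. Poly_Mapping.lookup x i = 0)}"

definition cube_phi :: "nat \<Rightarrow> nat" where
  "cube_phi d = (LEAST k. \<exists>T. triangulates d T (unit_cube d) \<and> card T = k)"

text \<open>
  At \<open>d = 0\<close> the value \<open>cube_rho 0\<close> is irrelevant: \<open>cube_rho 0 ^ 0 = 1\<close>, as the convention demands.
\<close>

definition cube_rho :: "nat \<Rightarrow> real" where
  "cube_rho d = root d (real (cube_phi d) / fact d)"

text \<open>
  The type of \<open>\<tau>\<close>, where \<open>v 1, \<dots>, v m\<close> are the vertices of the simplex factor. The truncated
  subtraction is harmless: a full-dimensional \<open>\<tau>\<close> has a vertex over every \<open>v i\<close>.
\<close>

definition simplex_type :: "(nat \<Rightarrow> 'b) \<Rightarrow> ('a \<times> 'b) set \<Rightarrow> nat \<Rightarrow> nat" where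
  "simplex_type v \<tau> i = card {p \<in> \<tau>. snd p = v i} - 1"

definition weight :: "nat \<Rightarrow> (nat \<Rightarrow> 'b) \<Rightarrow> ('a \<times> 'b) set \<Rightarrow> real" where
  "weight m v \<tau> = 1 / (\<Prod>i=1..m. fact (simplex_type v \<tau> i))"

definition weighted_efficiency ::
    "nat \<Rightarrow> nat \<Rightarrow> (nat \<Rightarrow> 'b) \<Rightarrow> ('a \<times> 'b) set set \<Rightarrow> real" where
  "weighted_efficiency l m v T = root l ((\<Sum>\<tau>\<in>T. weight m v \<tau>) / real m ^ l)"

end

theory Submission
  imports Defs
begin

text \<open>
  Colour the vertices of the cube \<open>I\<^bsup>n-1\<^esup>\<close> with the \<open>m\<close> vertices of the simplex \<open>\<Delta>\<^bsup>m-1\<^esup>\<close>. The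
  colouring maps every simplex \<open>\<sigma>\<close> of a minimal triangulation of \<open>I\<^bsup>n-1\<^esup>\<close> affinely to
  \<open>\<Delta>\<^bsup>m-1\<^esup>\<close>, and pulling \<open>T\<^sub>0\<close> back along this map subdivides \<open>I\<^bsup>l\<^esup> \<times> \<sigma>\<close> into joins of products
  of simplices, one product per colour, each of which gets its staircase triangulation. A simplex of type
  \<open>(t\<^sub>1, \<dots>, t\<^sub>m)\<close> over a \<open>\<sigma>\<close> with \<open>k\<^sub>i\<close> vertices of colour \<open>i\<close> contributes
  \<open>\<Prod> k\<^sub>i (k\<^sub>i + 1) \<dots> (k\<^sub>i + t\<^sub>i - 1) / t\<^sub>i!\<close> simplices. Averaged over all colourings this is at most
  \<open>(n/m + l)\<^sup>l / \<Prod> t\<^sub>i!\<close>, so some colouring gives a triangulation of \<open>I\<^bsup>n+l-1\<^esup>\<close> with at most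
  \<open>\<phi>\<^bsub>n-1\<^esub> (n + l m)\<^sup>l\<close> times the \<open>l\<close>-th power of the weighted efficiency many simplices.

  That the pieces form a triangulation is checked pointwise: a point of \<open>I\<^bsup>l\<^esup> \<times> I\<^bsup>n-1\<^esup>\<close> has unique
  barycentric coordinates in \<open>\<sigma>\<close>, its image has unique ones in \<open>T\<^sub>0\<close>, and two distributions of
  equal mass on chains have exactly one coupling supported on a staircase.

  For \<open>m = 1\<close> the inequality says that \<open>limsup \<rho>\<^sub>i \<le> \<rho>\<^sub>l\<close> for all \<open>l\<close>, so the sequence converges to
  its infimum.
\<close>

section \<open>Simplicial covers and barycentric coordinates\<close>

text \<open>Coefficients are total functions that vanish off the simplex, so coordinates with
  respect to different simplices can be compared by plain equality of functions.\<close>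

definition convex_coeffs :: "'a set \<Rightarrow> ('a \<Rightarrow> real) \<Rightarrow> bool" where
  "convex_coeffs S a \<longleftrightarrow> (\<forall>x. 0 \<le> a x) \<and> (\<forall>x. x \<notin> S \<longrightarrow> a x = 0) \<and> sum a S = 1"

definition barycentre :: "'a::real_vector set \<Rightarrow> ('a \<Rightarrow> real) \<Rightarrow> 'a" where
  "barycentre S a = (\<Sum>x\<in>S. a x *\<^sub>R x)"

lemma convex_coeffsD:
  assumes "convex_coeffs S a"
  shows "0 \<le> a x" "x \<notin> S \<Longrightarrow> a x = 0" "sum a S = 1"
  using assms by (auto simp: convex_coeffs_def)

lemma in_convex_hull_iff_coeffs:
  fixes S :: "'a::real_vector set"
  assumes "finite S"
  shows "y \<in> convex hull S \<longleftrightarrow> (\<exists>a. convex_coeffs S a \<and> barycentre S a = y)"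
proof
  assume "y \<in> convex hull S"
  then obtain u where u: "\<forall>x\<in>S. 0 \<le> u x" "sum u S = 1" "(\<Sum>x\<in>S. u x *\<^sub>R x) = y"
    unfolding convex_hull_finite[OF assms] by blast
  let ?a = "\<lambda>x. if x \<in> S then u x else 0"
  have "convex_coeffs S ?a" "barycentre S ?a = y"
    using u by (auto simp: convex_coeffs_def barycentre_def cong: sum.cong)
  then show "\<exists>a. convex_coeffs S a \<and> barycentre S a = y" by blast
next
  assume "\<exists>a. convex_coeffs S a \<and> barycentre S a = y"
  then show "y \<in> convex hull S"
    unfolding convex_hull_finite[OF assms] convex_coeffs_def barycentre_def by blast
qed

lemma convex_coeffs_superset:
  assumes "convex_coeffs S a" "S \<subseteq> S'" "finite S'"
  shows "convex_coeffs S' a" "barycentre S' a = barycentre S a"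
proof -
  have "sum a S' = sum a S" "barycentre S' a = barycentre S a"
    unfolding barycentre_def
    by (rule sum.mono_neutral_right; use assms in \<open>auto simp: convex_coeffs_def\<close>)+
  then show "convex_coeffs S' a" "barycentre S' a = barycentre S a"
    using assms unfolding convex_coeffs_def by (metis subsetD)+
qed

lemma convex_coeffs_subset:
  assumes "convex_coeffs S a" "S' \<subseteq> S" "finite S" "\<And>x. x \<notin> S' \<Longrightarrow> a x = 0"
  shows "convex_coeffs S' a" "barycentre S' a = barycentre S a"
proof -
  have "sum a S' = sum a S" "barycentre S' a = barycentre S a"
    unfolding barycentre_def
    by (rule sum.mono_neutral_left; use assms in \<open>auto simp: convex_coeffs_def\<close>)+
  then show "convex_coeffs S' a" "barycentre S' a = barycentre S a"
    using assms unfolding convex_coeffs_def by (metis subsetD)+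
qed

lemma convex_coeffs_mix:
  assumes "convex_coeffs S a" "convex_coeffs S b" "0 \<le> t" "t \<le> 1"
  shows "convex_coeffs S (\<lambda>x. (1 - t) * a x + t * b x)"
  using assms by (auto simp: convex_coeffs_def sum.distrib simp flip: sum_distrib_left)

lemma barycentre_mix:
  "barycentre S (\<lambda>x. s * a x + t * b x) = s *\<^sub>R barycentre S a + t *\<^sub>R barycentre S b"
  by (simp add: barycentre_def scaleR_sum_right scaleR_add_left sum.distrib)

lemma affine_independent_coeffs_unique:
  fixes S :: "'a::real_vector set"
  assumes "finite S" "\<not> affine_dependent S" "sum a S = sum b S"
    and "barycentre S a = barycentre S b" "x \<in> S"
  shows "a x = b x"
proof (rule ccontr)
  assume "a x \<noteq> b x"
  then have "\<exists>v\<in>S. a v - b v \<noteq> 0" using assms(5) by auto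
  moreover have "sum (\<lambda>v. a v - b v) S = 0" using assms(3) by (simp add: sum_subtractf)
  moreover have "(\<Sum>v\<in>S. (a v - b v) *\<^sub>R v) = 0"
    using assms(4) by (simp add: barycentre_def scaleR_diff_left sum_subtractf)
  ultimately show False
    using assms(1,2) by (auto simp: affine_dependent_explicit_finite)
qed

text \<open>Radon's argument: the positive and the negative part of an affine dependence, each
  divided by its total mass, are two different convex combinations of the same point.\<close>

lemma convex_coeffs_unique_imp_affine_independent:
  fixes S :: "'a::real_vector set"
  assumes "finite S"
    and uniq: "\<And>a b. convex_coeffs S a \<Longrightarrow> convex_coeffs S b \<Longrightarrow>
                 barycentre S a = barycentre S b \<Longrightarrow> a = b"
  shows "\<not> affine_dependent S"
proof
  assume "affine_dependent S"
  then obtain u v where u: "sum u S = 0" "v \<in> S" "u v \<noteq> 0" "(\<Sum>x\<in>S. u x *\<^sub>R x) = 0"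
    using assms(1) by (auto simp: affine_dependent_explicit_finite)
  define c where "c = (\<Sum>x\<in>S. max (u x) 0)"
  define a where "a = (\<lambda>x. if x \<in> S then max (u x) 0 / c else 0)"
  define b where "b = (\<lambda>x. if x \<in> S then max (- u x) 0 / c else 0)"
  have ud: "u x = max (u x) 0 - max (- u x) 0" for x by auto
  have c': "c = (\<Sum>x\<in>S. max (- u x) 0)"
  proof -
    have "sum u S = (\<Sum>x\<in>S. max (u x) 0 - max (- u x) 0)" by (rule sum.cong) auto
    then show ?thesis using u(1) by (simp add: c_def sum_subtractf)
  qed
  have "c > 0"
  proof (cases "u v > 0")
    case True
    then show ?thesis unfolding c_def
      by (intro sum_pos2[OF assms(1) u(2)]) auto
  next
    case False
    then show ?thesis unfolding c' using u(3)
      by (intro sum_pos2[OF assms(1) u(2)]) auto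
  qed
  have sa: "sum a S = 1"
    using \<open>c > 0\<close> by (simp add: a_def c_def flip: sum_divide_distrib)
  have "sum b S = (\<Sum>x\<in>S. max (- u x) 0) / c"
    by (simp add: b_def flip: sum_divide_distrib)
  then have sb: "sum b S = 1"
    using \<open>c > 0\<close> c' by simp
  have coeffs: "convex_coeffs S a" "convex_coeffs S b"
    using sa sb \<open>c > 0\<close> by (auto simp: convex_coeffs_def a_def b_def)
  have "barycentre S a - barycentre S b = (\<Sum>x\<in>S. (a x - b x) *\<^sub>R x)"
    by (simp add: barycentre_def scaleR_diff_left sum_subtractf)
  also have "\<dots> = (\<Sum>x\<in>S. (1 / c) *\<^sub>R (u x *\<^sub>R x))"
  proof (rule sum.cong[OF refl])
    fix x assume "x \<in> S"
    then have "a x - b x = u x / c"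
      using ud[of x] by (simp add: a_def b_def flip: diff_divide_distrib)
    then show "(a x - b x) *\<^sub>R x = (1 / c) *\<^sub>R (u x *\<^sub>R x)" by simp
  qed
  also have "\<dots> = 0" using u(4) by (simp only: scaleR_sum_right[symmetric]) simp
  finally have "a = b" using uniq[OF coeffs] by simp
  then have "a v = b v" by simp
  then show False using u(2,3) \<open>c > 0\<close> by (auto simp: a_def b_def max_def split: if_splits)
qed

definition simplicial_cover :: "'a::real_vector set set \<Rightarrow> 'a set \<Rightarrow> bool" where
  "simplicial_cover K X \<longleftrightarrow>
     finite K \<and> (\<forall>S\<in>K. finite S \<and> S \<subseteq> {x. x extreme_point_of X}) \<and>
     (\<Union>S\<in>K. convex hull S) = X \<and>
     (\<forall>S\<in>K. \<forall>S'\<in>K. \<forall>a a'. convex_coeffs S a \<longrightarrow> convex_coeffs S' a' \<longrightarrow>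
        barycentre S a = barycentre S' a' \<longrightarrow> a = a')"

lemma simplicial_coverD:
  assumes "simplicial_cover K X"
  shows "finite K" "S \<in> K \<Longrightarrow> finite S" "S \<in> K \<Longrightarrow> S \<subseteq> {x. x extreme_point_of X}"
    "(\<Union>S\<in>K. convex hull S) = X"
    "S \<in> K \<Longrightarrow> S' \<in> K \<Longrightarrow> convex_coeffs S a \<Longrightarrow> convex_coeffs S' a' \<Longrightarrow>
        barycentre S a = barycentre S' a' \<Longrightarrow> a = a'"
  using assms unfolding simplicial_cover_def by blast+

lemma simplicial_cover_affine_independent:
  assumes "simplicial_cover K X" "S \<in> K"
  shows "\<not> affine_dependent S"
  by (rule convex_coeffs_unique_imp_affine_independent)
    (use simplicial_coverD[OF assms(1)] assms(2) in blast)+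

text \<open>Splitting off \<open>v\<close> writes the barycentre as an inner point of the segment
  from \<open>v\<close> to the barycentre \<open>w\<close> of the rest, and a face containing an
  inner point of a segment contains its ends.\<close>

lemma barycentre_in_face:
  fixes S :: "'a::real_vector set"
  assumes "finite S" and a: "convex_coeffs S a" and F: "F face_of (convex hull S)"
    and bF: "barycentre S a \<in> F" and v: "v \<in> S" "a v \<noteq> 0"
  shows "v \<in> F"
proof (cases "a v = 1")
  case True
  then have "sum a (S - {v}) = 0"
    using convex_coeffsD(3)[OF a] v(1) assms(1) by (simp add: sum_diff1)
  then have "\<forall>x\<in>S - {v}. a x = 0"
    using assms(1) convex_coeffsD(1)[OF a] by (subst (asm) sum_nonneg_eq_0_iff) auto
  then have "barycentre S a = (\<Sum>x\<in>{v}. a x *\<^sub>R x)"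
    unfolding barycentre_def using v(1) assms(1) by (intro sum.mono_neutral_right) auto
  then show ?thesis using bF True by simp
next
  case False
  define t where "t = a v"
  have "a v \<le> sum a S" using assms(1) v(1) convex_coeffsD(1)[OF a]
    by (intro member_le_sum) auto
  then have t: "0 < t" "t < 1"
    using False v(2) convex_coeffsD(1)[OF a, of v] convex_coeffsD(3)[OF a] by (auto simp: t_def)
  define b where "b = (\<lambda>x. if x = v then 0 else a x / (1 - t))"
  have "sum b S = sum b (S - {v})"
    using assms(1) by (intro sum.mono_neutral_right) (auto simp: b_def)
  also have "\<dots> = (\<Sum>x\<in>S - {v}. a x / (1 - t))" by (rule sum.cong) (auto simp: b_def)
  also have "\<dots> = sum a (S - {v}) / (1 - t)" by (simp flip: sum_divide_distrib)
  also have "sum a (S - {v}) = 1 - t"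
    using convex_coeffsD(3)[OF a] v(1) assms(1) by (simp add: sum_diff1 t_def)
  finally have "sum b S = 1" using t by simp
  then have b: "convex_coeffs S b"
    using a t by (auto simp: convex_coeffs_def b_def)
  define w where "w = barycentre S b"
  have w: "w \<in> convex hull S" using b assms(1) in_convex_hull_iff_coeffs w_def by blast
  define e where "e = (\<lambda>x. if x = v then 1 else 0 :: real)"
  have "barycentre S e = (\<Sum>x\<in>{v}. e x *\<^sub>R x)"
    unfolding barycentre_def using v(1) assms(1)
    by (intro sum.mono_neutral_right) (auto simp: e_def)
  then have be: "barycentre S e = v" by (simp add: e_def)
  have "a = (\<lambda>x. (1 - t) * b x + t * e x)"
    using t by (auto simp: b_def e_def t_def)
  then have eq: "barycentre S a = (1 - t) *\<^sub>R w + t *\<^sub>R v"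
    using barycentre_mix[of S "1 - t" b t e] be w_def by simp
  have vS: "v \<in> convex hull S" using v(1) by (simp add: hull_inc)
  show ?thesis
  proof (cases "w = v")
    case True
    then have "barycentre S a = v" using eq by (simp flip: scaleR_add_left)
    then show ?thesis using bF by simp
  next
    case False
    then have "barycentre S a \<in> open_segment w v"
      using t eq in_segment(2) by blast
    then show ?thesis using F bF w vS unfolding face_of_def by blast
  qed
qed

section \<open>Triangulations as simplicial covers\<close>

lemma triangulates_finite:
  assumes "triangulates d T X" "\<tau> \<in> T"
  shows "finite \<tau>"
  using assms by (metis Suc_eq_plus1 card.infinite nat.distinct(1) triangulates_def)

text \<open>A point common to two simplices lies in their common face, so the vertices that carry
  its coordinates in \<open>S\<close> lie there too and, being extreme in \<open>X\<close>, are
  vertices of \<open>S'\<close>. Both coordinate functions then live on the affinely independent set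
  \<open>S'\<close>.\<close>

lemma triangulates_imp_simplicial_cover:
  assumes T: "triangulates d T X"
  shows "simplicial_cover T X"
  unfolding simplicial_cover_def
proof (intro conjI ballI allI impI)
  show "finite T" using T by (simp add: triangulates_def)
  show "\<Union> ((hull) convex ` T) = X" using T by (simp add: triangulates_def)
next
  fix S assume S: "S \<in> T"
  show "finite S" using triangulates_finite[OF T S] .
  show "S \<subseteq> {x. x extreme_point_of X}" using T S by (simp add: triangulates_def)
next
  fix S S' a a'
  assume S: "S \<in> T" "S' \<in> T" and a: "convex_coeffs S a" "convex_coeffs S' a'"
    and eq: "barycentre S a = barycentre S' a'"
  have fin: "finite S" "finite S'" using triangulates_finite[OF T] S by auto
  let ?F = "convex hull S \<inter> convex hull S'"
  have F: "?F face_of (convex hull S)" using T S by (simp add: triangulates_def)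
  have "barycentre S a \<in> convex hull S" "barycentre S' a' \<in> convex hull S'"
    using a in_convex_hull_iff_coeffs fin by blast+
  then have bF: "barycentre S a \<in> ?F" using eq by simp
  have supp: "a v = 0" if "v \<notin> S'" for v
  proof (rule ccontr)
    assume nz: "a v \<noteq> 0"
    then have vS: "v \<in> S" using convex_coeffsD(2)[OF a(1)] by blast
    have "v \<in> ?F" by (rule barycentre_in_face[OF fin(1) a(1) F bF vS nz])
    then have vh: "v \<in> convex hull S'" by simp
    have "convex hull S' \<subseteq> X" using T S by (auto simp: triangulates_def)
    moreover have "v extreme_point_of X" using T S vS by (auto simp: triangulates_def)
    ultimately have "v extreme_point_of (convex hull S')"
      using vh by (auto simp: extreme_point_of_def)
    then have "v \<in> S'" by (rule extreme_point_of_convex_hull)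
    then show False using that by simp
  qed
  have a': "convex_coeffs S' a" "barycentre S' a = barycentre S a"
  proof -
    have "convex_coeffs (S \<inter> S') a" "barycentre (S \<inter> S') a = barycentre S a"
      using convex_coeffs_subset[OF a(1), of "S \<inter> S'"] fin supp convex_coeffsD(2)[OF a(1)] by auto
    then show "convex_coeffs S' a" "barycentre S' a = barycentre S a"
      using convex_coeffs_superset[of "S \<inter> S'" a S'] fin by auto
  qed
  show "a = a'"
  proof
    fix x
    show "a x = a' x"
    proof (cases "x \<in> S'")
      case True
      have "\<not> affine_dependent S'" using T S by (simp add: triangulates_def)
      then show ?thesis
        using affine_independent_coeffs_unique[OF fin(2) _ _ _ True, of a a'] a' a(2) eq
        by (auto simp: convex_coeffs_def)
    next
      case False
      then show ?thesis using convex_coeffsD(2)[OF a(2)] supp by auto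
    qed
  qed
qed

section \<open>Affine dimension and the removal of lower-dimensional simplices\<close>

lemma card_le_affine_hull:
  fixes B W :: "'a::real_vector set"
  assumes "\<not> affine_dependent B" "B \<subseteq> affine hull W" "finite W"
  shows "finite B" "card B \<le> card W"
proof -
  have "finite B \<and> card B \<le> card W"
  proof (cases "B = {}")
    case False
    then obtain b where b: "b \<in> B" by blast
    then have "W \<noteq> {}" using assms(2) by auto
    then obtain w where w: "w \<in> W" by blast
    \<comment> \<open>Moving \<open>b\<close> and \<open>w\<close> to the origin reduces the claim
      to linear algebra: an independent set in a span is no larger than the spanning set.\<close>
    let ?B = "(\<lambda>x. - b + x) ` (B - {b})" and ?W = "(\<lambda>x. - w + x) ` (W - {w})"
    have hull: "affine hull W = (\<lambda>x. w + x) ` span ?W"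
      using affine_hull_insert_span_gen[of w "W - {w}"] w by (simp add: insert_absorb)
    have "independent ?B"
      using affine_dependent_iff_dependent2[OF b] assms(1) by simp
    moreover have "?B \<subseteq> span ?W"
    proof
      fix y assume "y \<in> ?B"
      then obtain x where x: "x \<in> B" "y = - b + x" by blast
      then obtain z z' where "z \<in> span ?W" "z' \<in> span ?W" "x = w + z" "b = w + z'"
        using b assms(2) unfolding hull by blast
      then show "y \<in> span ?W" using x(2) span_diff[of z ?W z'] by simp
    qed
    ultimately have *: "finite ?B" "card ?B \<le> card ?W"
      using independent_span_bound[of ?W ?B] assms(3) by auto
    have inj: "inj_on (\<lambda>x. - b + x) (B - {b})" by (auto simp: inj_on_def)
    have "finite (B - {b})" using *(1) inj finite_imageD by blast
    then have fin: "finite B" by simp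
    have "card ?B = card B - 1" using card_image[OF inj] b fin by simp
    moreover have "card ?W \<le> card W - 1"
      using card_image_le[of "W - {w}" "\<lambda>x. - w + x"] w assms(3) by simp
    ultimately show ?thesis using * fin card_gt_0_iff[of W] w assms(3) by fastforce
  qed auto
  then show "finite B" "card B \<le> card W" by auto
qed

lemma affine_line_two_points:
  fixes p q :: "'a::real_vector"
  assumes "affine H" "p + s *\<^sub>R (q - p) \<in> H" "p + t *\<^sub>R (q - p) \<in> H" "s \<noteq> t"
  shows "p + r *\<^sub>R (q - p) \<in> H"
proof -
  let ?k = "(r - s) / (t - s)"
  have "(1 - ?k) *\<^sub>R (p + s *\<^sub>R (q - p)) + ?k *\<^sub>R (p + t *\<^sub>R (q - p)) \<in> H"
    using assms(1,2,3) unfolding affine_def by (metis diff_add_cancel)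
  moreover have "(1 - ?k) *\<^sub>R (p + s *\<^sub>R (q - p)) + ?k *\<^sub>R (p + t *\<^sub>R (q - p))
      = ((1 - ?k) + ?k) *\<^sub>R p + ((1 - ?k) * s + ?k * t) *\<^sub>R (q - p)"
    by (simp only: scaleR_add_left scaleR_add_right scaleR_scaleR) simp
  moreover have "(1 - ?k) * s + ?k * t = s + ?k * (t - s)"
    by (simp only: algebra_simps)
  then have "(1 - ?k) * s + ?k * t = r"
    using assms(4) by simp
  ultimately show ?thesis by simp
qed

text \<open>If no member contains \<open>X\<close>, take \<open>p\<close> outside \<open>H\<close>
  and \<open>q\<close> outside all the others. A member meeting the segment in two points would
  contain its whole line, hence both \<open>p\<close> and \<open>q\<close>; so finitely many points
  would cover a segment.\<close>

lemma convex_subset_Union_affine: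
  fixes X :: "'a::real_vector set"
  assumes "finite \<H>" "convex X" "X \<noteq> {}" "X \<subseteq> \<Union>\<H>" "\<And>H. H \<in> \<H> \<Longrightarrow> affine H"
  shows "\<exists>H\<in>\<H>. X \<subseteq> H"
  using assms
proof (induction \<H>)
  case empty
  then show ?case by auto
next
  case (insert H \<H>)
  show ?case
  proof (rule ccontr)
    assume neg: "\<not> (\<exists>H\<in>insert H \<H>. X \<subseteq> H)"
    then obtain p where p: "p \<in> X" "p \<notin> H" by auto
    have "\<not> X \<subseteq> \<Union>\<H>" using insert neg by blast
    then obtain q where q: "q \<in> X" "q \<notin> \<Union>\<H>" by auto
    define L where "L = (\<lambda>t::real. p + t *\<^sub>R (q - p))"
    have "L t \<in> X" if "t \<in> {0..1}" for t
    proof -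
      have "L t = (1 - t) *\<^sub>R p + t *\<^sub>R q" by (simp add: L_def algebra_simps)
      then show ?thesis using insert.prems(1) p(1) q(1) that by (simp add: convexD)
    qed
    then have "{0..1} \<subseteq> (\<Union>H'\<in>insert H \<H>. {t. L t \<in> H'})"
      using insert.prems(3) by blast
    moreover have "finite {t. L t \<in> H'}" if H': "H' \<in> insert H \<H>" for H'
    proof (rule ccontr)
      assume "infinite {t. L t \<in> H'}"
      then obtain s t where "L s \<in> H'" "L t \<in> H'" "s \<noteq> t"
        by (metis (mono_tags, lifting) finite.emptyI finite_insert insertI1 infinite_super mem_Collect_eq subsetI)
      then have all: "L r \<in> H'" for r
        using affine_line_two_points[of H' p s q t r] insert.prems(4)[OF H'] by (simp add: L_def)
      from all[of 0] all[of 1] have "p \<in> H'" "q \<in> H'" by (auto simp: L_def)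
      then show False using p q H' by auto
    qed
    then have "finite (\<Union>H'\<in>insert H \<H>. {t. L t \<in> H'})" using insert.hyps by blast
    ultimately have "finite {0..1::real}" using finite_subset by blast
    then show False by (simp add: infinite_Icc)
  qed
qed

text \<open>By uniqueness the coordinates of an inner point \<open>z\<close> in \<open>S\<close> are
  those in \<open>S'\<close>, so they vanish off \<open>S'\<close>. A mixture of nonnegative
  functions with positive weights vanishes only where both do, so the ends of the segment lie in the
  hull of \<open>S \<inter> S'\<close>.\<close>

lemma convex_hull_Int_face_of:
  assumes K: "simplicial_cover K X" and S: "S \<in> K" "S' \<in> K"
  shows "(convex hull S \<inter> convex hull S') face_of (convex hull S)"
  unfolding face_of_def
proof (intro conjI ballI impI)
  have fin: "finite S" "finite S'" using simplicial_coverD(2)[OF K] S by auto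
  fix x y z
  assume x: "x \<in> convex hull S" and y: "y \<in> convex hull S"
    and z: "z \<in> convex hull S \<inter> convex hull S'" and seg: "z \<in> open_segment x y"
  obtain a where a: "convex_coeffs S a" "barycentre S a = x"
    using x in_convex_hull_iff_coeffs[OF fin(1)] by blast
  obtain b where b: "convex_coeffs S b" "barycentre S b = y"
    using y in_convex_hull_iff_coeffs[OF fin(1)] by blast
  obtain c where c: "convex_coeffs S' c" "barycentre S' c = z"
    using z in_convex_hull_iff_coeffs[OF fin(2)] by blast
  obtain t where t: "0 < t" "t < 1" "z = (1 - t) *\<^sub>R x + t *\<^sub>R y"
    using seg in_segment(2) by blast
  have "(\<lambda>v. (1 - t) * a v + t * b v) = c"
    using simplicial_coverD(5)[OF K S convex_coeffs_mix[OF a(1) b(1)] c(1)]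
      barycentre_mix[of S "1 - t" a t b] a(2) b(2) c(2) t by simp
  then have z0: "(1 - t) * a v + t * b v = 0" if "v \<notin> S'" for v
    using convex_coeffsD(2)[OF c(1) that] by meson
  have a0: "a v = 0" and b0: "b v = 0" if "v \<notin> S'" for v
    using z0[OF that] t convex_coeffsD(1)[OF a(1), of v] convex_coeffsD(1)[OF b(1), of v]
    by (auto simp: add_nonneg_eq_0_iff)
  have "u \<in> convex hull S'"
    if e: "convex_coeffs S e" "barycentre S e = u" "\<And>v. v \<notin> S' \<Longrightarrow> e v = 0" for e u
  proof -
    have "convex_coeffs (S \<inter> S') e" "barycentre (S \<inter> S') e = u"
      using convex_coeffs_subset[OF e(1), of "S \<inter> S'"] fin e convex_coeffsD(2)[OF e(1)] by auto
    then have "u \<in> convex hull (S \<inter> S')"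
      using in_convex_hull_iff_coeffs[of "S \<inter> S'"] fin by blast
    then show ?thesis using hull_mono[of "S \<inter> S'" S' convex] by blast
  qed
  then show "x \<in> convex hull S \<inter> convex hull S'" "y \<in> convex hull S \<inter> convex hull S'"
    using x y a b a0 b0 by blast+
qed (auto intro: convex_Int)

text \<open>
  The simplices of smaller dimension are redundant: a generic segment issuing from a point avoids
  them, and one full-dimensional simplex contains its initial part, hence also its starting point.
\<close>

lemma simplicial_cover_full_dimensional:
  fixes X :: "'a::real_vector set"
  assumes K: "simplicial_cover K X" and X: "convex X"
    and B: "B \<subseteq> X" "\<not> affine_dependent B" "card B = d + 1"
    and le: "\<And>S. S \<in> K \<Longrightarrow> card S \<le> d + 1" and x: "x \<in> X"
  shows "\<exists>S\<in>K. card S = d + 1 \<and> x \<in> convex hull S"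
proof -
  let ?Low = "{S\<in>K. card S < d + 1}"
  have "\<not> X \<subseteq> \<Union> ((hull) affine ` ?Low)"
  proof
    assume "X \<subseteq> \<Union> ((hull) affine ` ?Low)"
    then have "\<exists>H\<in>(hull) affine ` ?Low. X \<subseteq> H"
      using X x simplicial_coverD(1)[OF K] by (intro convex_subset_Union_affine) auto
    then obtain S where S: "S \<in> ?Low" "X \<subseteq> affine hull S" by blast
    then have "card B \<le> card S"
      using card_le_affine_hull[of B S] B simplicial_coverD(2)[OF K] by blast
    then show False using S(1) B(3) by simp
  qed
  then obtain z where z: "z \<in> X" "\<And>S. S \<in> ?Low \<Longrightarrow> z \<notin> affine hull S" by blast
  define L where "L = (\<lambda>t::real. x + t *\<^sub>R (z - x))"
  \<comment> \<open>The points \<open>L (s k)\<close> tend to \<open>x\<close> along the segment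
    from the generic point \<open>z\<close>; by the pigeonhole principle one simplex contains
    infinitely many of them.\<close>
  define s where "s = (\<lambda>k::nat. 1 / real (Suc k))"
  have "\<exists>S\<in>K. L (s k) \<in> convex hull S" for k
  proof -
    have "L (s k) = (1 - s k) *\<^sub>R x + s k *\<^sub>R z" by (simp add: L_def algebra_simps)
    then have "L (s k) \<in> X" using X x z(1) by (simp add: convexD s_def)
    then show ?thesis using simplicial_coverD(4)[OF K] by blast
  qed
  then obtain \<sigma> where \<sigma>: "\<And>k. \<sigma> k \<in> K" "\<And>k. L (s k) \<in> convex hull (\<sigma> k)" by metis
  have "finite (\<sigma> ` UNIV)"
    using \<sigma>(1) simplicial_coverD(1)[OF K] finite_subset by (metis image_subsetI)
  then obtain k0 where k0: "infinite {k. \<sigma> k = \<sigma> k0}"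
    using pigeonhole_infinite[of UNIV \<sigma>] by auto
  define S where "S = \<sigma> k0"
  define N where "N = {k. \<sigma> k = S}"
  have N: "infinite N" using k0 by (simp add: N_def S_def)
  have S: "S \<in> K" "finite S" using \<sigma>(1) simplicial_coverD(2)[OF K] by (auto simp: S_def)
  have hull: "L (s k) \<in> convex hull S" if "k \<in> N" for k using that \<sigma>(2)[of k] by (simp add: N_def)
  obtain i where i: "i \<in> N" using infinite_imp_nonempty[OF N] by blast
  obtain j where j: "j \<in> N" "j \<noteq> i"
    using infinite_imp_nonempty[OF infinite_remove[OF N, of i]] by blast
  have sij: "s i \<noteq> s j" using j by (simp add: s_def)
  have "card S = d + 1"
  proof (rule ccontr)
    assume "card S \<noteq> d + 1"
    then have low: "S \<in> ?Low" using le[OF S(1)] S(1) by simp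
    have "L (s i) \<in> affine hull S" "L (s j) \<in> affine hull S"
      using hull[OF i] hull[OF j(1)] convex_hull_subset_affine_hull by blast+
    then have "x + 1 *\<^sub>R (z - x) \<in> affine hull S"
      using affine_line_two_points[of "affine hull S" x "s i" z "s j" 1] sij by (auto simp: L_def)
    then show False using z(2)[OF low] by simp
  qed
  have "\<forall>k\<in>N. \<exists>a. convex_coeffs S a \<and> barycentre S a = L (s k)"
    using hull in_convex_hull_iff_coeffs[OF S(2)] by blast
  from bchoice[OF this] obtain w where w: "\<And>k. k \<in> N \<Longrightarrow> convex_coeffs S (w k)"
    "\<And>k. k \<in> N \<Longrightarrow> barycentre S (w k) = L (s k)" by blast
  \<comment> \<open>\<open>r\<close> sends \<open>s i\<close> to 0 and \<open>s j\<close> to 1, so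
    \<open>a t\<close> extends the coordinates of two points affinely along the line; by affine
    independence of \<open>S\<close> it agrees with the true coordinates at \<open>s k\<close> for
    every \<open>k\<close> in \<open>N\<close>.\<close>
  define r where "r = (\<lambda>t. (t - s i) / (s j - s i))"
  define a where "a = (\<lambda>t v. (1 - r t) * w i v + r t * w j v)"
  have sum_a: "sum (a t) S = 1" for t
    using w(1)[OF i] w(1)[OF j(1)]
    by (simp add: a_def sum.distrib convex_coeffs_def flip: sum_distrib_left)
  have bary_a: "barycentre S (a t) = L t" for t
  proof -
    have "barycentre S (a t) = (1 - r t) *\<^sub>R L (s i) + r t *\<^sub>R L (s j)"
      unfolding a_def barycentre_mix using w(2) i j(1) by simp
    also have "\<dots> = ((1 - r t) + r t) *\<^sub>R x + ((1 - r t) * s i + r t * s j) *\<^sub>R (z - x)"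
      unfolding L_def by (simp only: scaleR_add_left scaleR_add_right scaleR_scaleR) simp
    also have "(1 - r t) * s i + r t * s j = s i + r t * (s j - s i)"
      by (simp only: algebra_simps)
    also have "\<dots> = t" using sij by (simp add: r_def)
    finally show ?thesis by (simp add: L_def)
  qed
  have indep: "\<not> affine_dependent S" using simplicial_cover_affine_independent[OF K S(1)] .
  have nonneg: "0 \<le> a (s k) v" if "k \<in> N" "v \<in> S" for k v
  proof -
    have "a (s k) v = w k v"
      by (rule affine_independent_coeffs_unique[OF S(2) indep _ _ that(2)])
        (use sum_a bary_a w(2)[OF that(1)] convex_coeffsD(3)[OF w(1)[OF that(1)]] in simp_all)
    then show ?thesis using convex_coeffsD(1)[OF w(1)[OF that(1)]] by simp
  qed
  \<comment> \<open>Each coordinate is affine in \<open>t\<close> and nonnegative at arbitrarily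
    small positive \<open>t\<close>, hence at 0.\<close>
  have nonneg0: "0 \<le> a 0 v" if v: "v \<in> S" for v
  proof (rule ccontr)
    assume neg: "\<not> 0 \<le> a 0 v"
    define c where "c = (w j v - w i v) / (s j - s i)"
    have a_lin: "a t v = a 0 v + t * c" for t
    proof -
      have "r t = r 0 + t / (s j - s i)" by (simp add: r_def diff_divide_distrib)
      then have "a t v = a 0 v + t / (s j - s i) * (w j v - w i v)"
        by (simp only: a_def) (simp only: algebra_simps)
      then show ?thesis by (simp add: c_def)
    qed
    obtain n where n: "\<bar>c\<bar> / - a 0 v < real n" using reals_Archimedean2 by blast
    obtain k where k: "k \<in> N" "n \<le> k" using N by (meson infinite_nat_iff_unbounded_le)
    have "\<bar>c\<bar> < real n * - a 0 v" using n neg by (subst (asm) pos_divide_less_eq) auto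
    also have "\<dots> \<le> real (Suc k) * - a 0 v" using k(2) neg by (intro mult_right_mono) auto
    finally have "\<bar>c\<bar> * s k < - a 0 v" by (simp add: s_def field_simps)
    moreover have "s k * c \<le> \<bar>c\<bar> * s k"
      by (simp add: s_def abs_ge_self divide_right_mono)
    ultimately show False using nonneg[OF k(1) v] a_lin[of "s k"] by linarith
  qed
  define b where "b = (\<lambda>v. if v \<in> S then a 0 v else 0)"
  have "convex_coeffs S b" using nonneg0 sum_a[of 0] by (auto simp: convex_coeffs_def b_def cong: sum.cong)
  moreover have "barycentre S b = x" using bary_a[of 0]
    by (simp add: barycentre_def b_def L_def cong: sum.cong)
  ultimately have "x \<in> convex hull S" using in_convex_hull_iff_coeffs[OF S(2)] by blast
  then show ?thesis using S(1) \<open>card S = d + 1\<close> by blast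
qed

lemma simplicial_cover_imp_triangulates:
  assumes K: "simplicial_cover K X" and card: "\<And>S. S \<in> K \<Longrightarrow> card S = d + 1"
  shows "triangulates d K X"
  unfolding triangulates_def
proof (intro conjI ballI)
  fix S S' assume S: "S \<in> K" "S' \<in> K"
  show "(convex hull S \<inter> convex hull S') face_of (convex hull S)"
    using convex_hull_Int_face_of[OF K S] .
  show "(convex hull S \<inter> convex hull S') face_of (convex hull S')"
    using convex_hull_Int_face_of[OF K S(2,1)] by (simp add: Int_commute)
qed (use card simplicial_coverD(1,3,4)[OF K] simplicial_cover_affine_independent[OF K] in auto)

text \<open>\<open>B\<close> witnesses that \<open>X\<close> has dimension at least
  \<open>d\<close>, and the cardinality bound says that no simplex exceeds this dimension; the
  simplices of dimension \<open>d\<close> then cover \<open>X\<close> by themselves.\<close>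

lemma simplicial_cover_full_dimensional_triangulates:
  fixes X :: "'a::real_vector set"
  assumes K: "simplicial_cover K X" and X: "convex X"
    and B: "B \<subseteq> X" "\<not> affine_dependent B" "card B = d + 1"
    and le: "\<And>S. S \<in> K \<Longrightarrow> card S \<le> d + 1"
  shows "triangulates d {S\<in>K. card S = d + 1} X"
proof (rule simplicial_cover_imp_triangulates)
  have "X \<subseteq> (\<Union>S\<in>{S\<in>K. card S = d + 1}. convex hull S)"
    using simplicial_cover_full_dimensional[OF assms] by blast
  moreover have "(\<Union>S\<in>{S\<in>K. card S = d + 1}. convex hull S) \<subseteq> X"
    using simplicial_coverD(4)[OF K] by blast
  ultimately have "(\<Union>S\<in>{S\<in>K. card S = d + 1}. convex hull S) = X" by blast
  then show "simplicial_cover {S\<in>K. card S = d + 1} X"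
    unfolding simplicial_cover_def
    using simplicial_coverD(1,2,3)[OF K] simplicial_coverD(5)[OF K]
    by (intro conjI ballI allI impI) (auto 0 0)
qed simp

text \<open>Injectivity is asked on \<open>X\<close>, where all the barycentres lie; the
  concatenation of coordinates used later is not injective on the whole space.\<close>

lemma simplicial_cover_linear_image:
  fixes h :: "'a::real_vector \<Rightarrow> 'b::real_vector"
  assumes K: "simplicial_cover K X" and X: "convex X" and h: "linear h" "inj_on h X"
  shows "simplicial_cover ((`) h ` K) (h ` X)"
proof -
  have sub: "S \<subseteq> X" if "S \<in> K" for S
    using simplicial_coverD(3)[OF K that] unfolding extreme_point_of_def by blast
  have ext: "h x extreme_point_of (h ` X)" if x: "x extreme_point_of X" for x
    unfolding extreme_point_of_def
  proof (intro conjI ballI notI)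
    show "h x \<in> h ` X" using x by (simp add: extreme_point_of_def)
    fix y z assume yz: "y \<in> h ` X" "z \<in> h ` X" "h x \<in> open_segment y z"
    then obtain a b t where ab: "a \<in> X" "b \<in> X" "y = h a" "z = h b"
      and t: "0 < t" "t < 1" "h x = (1 - t) *\<^sub>R h a + t *\<^sub>R h b" "h a \<noteq> h b"
      by (auto simp: in_segment)
    have "h x = h ((1 - t) *\<^sub>R a + t *\<^sub>R b)"
      using t(3) h(1) by (simp add: linear_add linear_scale)
    moreover have "(1 - t) *\<^sub>R a + t *\<^sub>R b \<in> X" using X ab t by (simp add: convexD)
    ultimately have "x = (1 - t) *\<^sub>R a + t *\<^sub>R b"
      using h(2) x by (auto simp: extreme_point_of_def dest: inj_onD)
    then have "x \<in> open_segment a b" using t by (auto simp: in_segment)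
    then show False using x ab by (auto simp: extreme_point_of_def)
  qed
  have pull: "convex_coeffs S (\<lambda>x. if x \<in> S then a (h x) else 0)"
      "h (barycentre S (\<lambda>x. if x \<in> S then a (h x) else 0)) = barycentre (h ` S) a"
      "barycentre S (\<lambda>x. if x \<in> S then a (h x) else 0) \<in> X"
    if S: "S \<in> K" and a: "convex_coeffs (h ` S) a" for S a
  proof -
    have inj: "inj_on h S" using inj_on_subset[OF h(2) sub[OF S]] .
    show coeffs: "convex_coeffs S (\<lambda>x. if x \<in> S then a (h x) else 0)"
      using a sum.reindex[OF inj, of a] by (auto simp: convex_coeffs_def cong: sum.cong)
    have "barycentre (h ` S) a = (\<Sum>x\<in>S. a (h x) *\<^sub>R h x)"
      by (simp add: barycentre_def sum.reindex[OF inj])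
    also have "\<dots> = h (\<Sum>x\<in>S. a (h x) *\<^sub>R x)"
      using h(1) by (simp add: linear_sum linear_scale)
    finally show "h (barycentre S (\<lambda>x. if x \<in> S then a (h x) else 0)) = barycentre (h ` S) a"
      by (simp add: barycentre_def cong: sum.cong)
    have "barycentre S (\<lambda>x. if x \<in> S then a (h x) else 0) \<in> convex hull S"
      using coeffs in_convex_hull_iff_coeffs[OF simplicial_coverD(2)[OF K S]] by blast
    then show "barycentre S (\<lambda>x. if x \<in> S then a (h x) else 0) \<in> X"
      using simplicial_coverD(4)[OF K] S by blast
  qed
  have uniq: "a = a'"
    if S: "S \<in> K" "S' \<in> K" and a: "convex_coeffs (h ` S) a" "convex_coeffs (h ` S') a'"
      and eq: "barycentre (h ` S) a = barycentre (h ` S') a'" for S S' a a'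
  proof
    let ?b = "\<lambda>x. if x \<in> S then a (h x) else 0" and ?b' = "\<lambda>x. if x \<in> S' then a' (h x) else 0"
    have "barycentre S ?b = barycentre S' ?b'"
      by (rule inj_onD[OF h(2)])
        (simp_all only: pull(2,3)[OF S(1) a(1)] pull(2,3)[OF S(2) a(2)] eq)
    then have bb: "?b = ?b'"
      using simplicial_coverD(5)[OF K S pull(1)[OF S(1) a(1)] pull(1)[OF S(2) a(2)]] by simp
    have mem: "h x \<in> h ` R \<longleftrightarrow> x \<in> R" if "x \<in> X" "R \<in> K" for x R
      using inj_on_image_mem_iff[OF h(2) that(1) sub[OF that(2)]] .
    fix y
    show "a y = a' y"
    proof (cases "y \<in> h ` S \<union> h ` S'")
      case True
      then obtain x where x: "y = h x" "x \<in> X" using sub S by blast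
      have "a y = ?b x" "a' y = ?b' x"
        using x mem[OF x(2) S(1)] mem[OF x(2) S(2)] convex_coeffsD(2)[OF a(1), of y]
          convex_coeffsD(2)[OF a(2), of y] by auto
      then show ?thesis using fun_cong[OF bb, of x] by simp
    next
      case False
      then show ?thesis using convex_coeffsD(2)[OF a(1)] convex_coeffsD(2)[OF a(2)] by simp
    qed
  qed
  show ?thesis
    unfolding simplicial_cover_def
  proof (intro conjI ballI allI impI)
    show "finite ((`) h ` K)" using simplicial_coverD(1)[OF K] by simp
    show "\<Union> ((hull) convex ` (`) h ` K) = h ` X"
    proof -
      have "\<Union> ((hull) convex ` (`) h ` K) = (\<Union>S\<in>K. h ` (convex hull S))"
        by (simp add: convex_hull_linear_image[OF h(1)])
      also have "\<dots> = h ` (\<Union>S\<in>K. convex hull S)" by blast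
      finally show ?thesis unfolding simplicial_coverD(4)[OF K] .
    qed
    show "finite S" if "S \<in> (`) h ` K" for S
      using that simplicial_coverD(2)[OF K] by auto
    show "S \<subseteq> {x. x extreme_point_of h ` X}" if "S \<in> (`) h ` K" for S
      using that simplicial_coverD(3)[OF K] ext by blast
  qed (use uniq in auto)
qed

lemma triangulates_linear_image:
  fixes h :: "'a::real_vector \<Rightarrow> 'b::real_vector"
  assumes T: "triangulates d T X" and X: "convex X" and h: "linear h" "inj_on h X"
  shows "triangulates d ((`) h ` T) (h ` X)"
proof (rule simplicial_cover_imp_triangulates)
  show "simplicial_cover ((`) h ` T) (h ` X)"
    by (rule simplicial_cover_linear_image[OF triangulates_imp_simplicial_cover[OF T] X h])
  fix S assume "S \<in> (`) h ` T"
  then obtain \<tau> where \<tau>: "\<tau> \<in> T" "S = h ` \<tau>" by blast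
  have "\<tau> \<subseteq> X" using T \<tau>(1) by (auto simp: triangulates_def extreme_point_of_def)
  then show "card S = d + 1"
    using T \<tau> card_image[OF inj_on_subset[OF h(2)]] by (simp add: triangulates_def)
qed

section \<open>Staircase couplings and coloured products\<close>

text \<open>\<open>f\<close> and \<open>g\<close> serve as rankings of the two vertex sets: a
  staircase is a chain of the product order, as in the staircase triangulation of a product of
  simplices.\<close>

definition staircase :: "('a \<Rightarrow> nat) \<Rightarrow> ('c \<Rightarrow> nat) \<Rightarrow> ('a \<times> 'c) set \<Rightarrow> bool" where
  "staircase f g S \<longleftrightarrow> (\<forall>(p, w)\<in>S. \<forall>(p', w')\<in>S.
     f p \<le> f p' \<and> g w \<le> g w' \<or> f p' \<le> f p \<and> g w' \<le> g w)"

lemma staircaseD: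
  "staircase f g S \<Longrightarrow> (p, w) \<in> S \<Longrightarrow> (p', w') \<in> S \<Longrightarrow>
     f p \<le> f p' \<and> g w \<le> g w' \<or> f p' \<le> f p \<and> g w' \<le> g w"
  unfolding staircase_def by blast

lemma staircase_subset: "staircase f g S \<Longrightarrow> S' \<subseteq> S \<Longrightarrow> staircase f g S'"
  unfolding staircase_def by blast

lemma staircase_insert_top:
  assumes "staircase f g S" "\<And>p w. (p, w) \<in> S \<Longrightarrow> f p \<le> f a \<and> g w \<le> g b"
  shows "staircase f g (insert (a, b) S)"
  using assms unfolding staircase_def by auto

text \<open>A transport plan with marginals \<alpha> and \<mu>. The total mass is left free, since
  every colour class has its own mass; the value 0 outside \<open>A \<times> B\<close> makes
  couplings comparable as functions.\<close>

definition coupling :: "'a set \<Rightarrow> 'c set \<Rightarrow> ('a \<Rightarrow> real) \<Rightarrow> ('c \<Rightarrow> real) \<Rightarrow> ('a \<times> 'c \<Rightarrow> real) \<Rightarrow> bool" where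
  "coupling A B \<alpha> \<mu> \<gamma> \<longleftrightarrow> (\<forall>z. 0 \<le> \<gamma> z) \<and> (\<forall>z. z \<notin> A \<times> B \<longrightarrow> \<gamma> z = 0) \<and>
     (\<forall>p\<in>A. (\<Sum>w\<in>B. \<gamma> (p, w)) = \<alpha> p) \<and> (\<forall>w\<in>B. (\<Sum>p\<in>A. \<gamma> (p, w)) = \<mu> w)"

lemma couplingD:
  assumes "coupling A B \<alpha> \<mu> \<gamma>"
  shows "0 \<le> \<gamma> z" "z \<notin> A \<times> B \<Longrightarrow> \<gamma> z = 0"
    "\<gamma> (p, w) \<noteq> 0 \<Longrightarrow> p \<in> A" "\<gamma> (p, w) \<noteq> 0 \<Longrightarrow> w \<in> B"
  using assms unfolding coupling_def by blast+

lemma coupling_swap: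
  "coupling A B \<alpha> \<mu> \<gamma> \<Longrightarrow> coupling B A \<mu> \<alpha> (\<lambda>(w, p). \<gamma> (p, w))"
  unfolding coupling_def by auto

text \<open>One move of the corner rule: the whole mass of row \<open>a\<close> goes to column
  \<open>b\<close>, whose remaining demand is lowered accordingly. As \<gamma> vanishes on row
  \<open>a\<close>, the update adds mass and overwrites none.\<close>

lemma coupling_add_top:
  assumes fin: "finite A" "finite B" and a: "a \<in> A" and b: "b \<in> B"
    and \<gamma>: "coupling (A - {a}) B \<alpha> (\<mu>(b := \<mu> b - \<alpha> a)) \<gamma>" and "0 \<le> \<alpha> a"
  shows "coupling A B \<alpha> \<mu> (\<gamma>((a, b) := \<alpha> a))"
proof -
  let ?\<gamma> = "\<gamma>((a, b) := \<alpha> a)"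
  have \<gamma>a: "\<gamma> (a, w) = 0" for w using \<gamma> by (auto simp: coupling_def)
  have "(\<Sum>w\<in>B. ?\<gamma> (p, w)) = \<alpha> p" if "p \<in> A" for p
  proof (cases "p = a")
    case True
    then have "(\<Sum>w\<in>B. ?\<gamma> (p, w)) = (\<Sum>w\<in>{b}. ?\<gamma> (p, w))"
      using b fin \<gamma>a by (intro sum.mono_neutral_right) auto
    then show ?thesis using True by simp
  next
    case False
    then show ?thesis using \<gamma> that by (auto simp: coupling_def)
  qed
  moreover have "(\<Sum>p\<in>A. ?\<gamma> (p, w)) = \<mu> w" if "w \<in> B" for w
  proof -
    have "(\<Sum>p\<in>A. ?\<gamma> (p, w)) = ?\<gamma> (a, w) + (\<Sum>p\<in>A - {a}. ?\<gamma> (p, w))"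
      using a fin by (simp add: sum.remove)
    also have "(\<Sum>p\<in>A - {a}. ?\<gamma> (p, w)) = (\<Sum>p\<in>A - {a}. \<gamma> (p, w))"
      by (rule sum.cong) auto
    also have "\<dots> = (\<mu>(b := \<mu> b - \<alpha> a)) w" using \<gamma> that by (auto simp: coupling_def)
    also have "?\<gamma> (a, w) + (\<mu>(b := \<mu> b - \<alpha> a)) w = \<mu> w" using \<gamma>a by auto
    finally show ?thesis .
  qed
  ultimately show ?thesis
    using \<gamma> a b assms(6) unfolding coupling_def by auto
qed

text \<open>The north-west corner rule of transportation theory, run from the top corner downwards.\<close>

lemma staircase_coupling_exists:
  assumes "finite A" "finite B" "\<And>p. p \<in> A \<Longrightarrow> 0 \<le> \<alpha> p" "\<And>w. w \<in> B \<Longrightarrow> 0 \<le> \<mu> w"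
    and "sum \<alpha> A = sum \<mu> B"
  shows "\<exists>\<gamma>. coupling A B \<alpha> \<mu> \<gamma> \<and> staircase f g {z. \<gamma> z \<noteq> 0}"
  using assms
proof (induction "card A + card B" arbitrary: A B \<alpha> \<mu> rule: less_induct)
  case less
  show ?case
  proof (cases "A = {} \<or> B = {}")
    case True
    then have "sum \<alpha> A = 0" "sum \<mu> B = 0" using less.prems(5) by auto
    then have "\<forall>p\<in>A. \<alpha> p = 0" "\<forall>w\<in>B. \<mu> w = 0"
      using less.prems sum_nonneg_eq_0_iff by metis+
    then have "coupling A B \<alpha> \<mu> (\<lambda>_. 0)" by (simp add: coupling_def)
    then show ?thesis by (intro exI[of _ "\<lambda>_. 0"]) (simp add: staircase_def)
  next
    case False
    obtain a where a: "a \<in> A" "\<And>p. p \<in> A \<Longrightarrow> f p \<le> f a"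
      using False less.prems(1) Max_in[of "f ` A"] Max_ge[of "f ` A"] by fastforce
    obtain b where b: "b \<in> B" "\<And>w. w \<in> B \<Longrightarrow> g w \<le> g b"
      using False less.prems(2) Max_in[of "g ` B"] Max_ge[of "g ` B"] by fastforce
    \<comment> \<open>The corner cell receives the smaller of the two masses; the exhausted row or
      column is removed and the rest is handled by induction.\<close>
    show ?thesis
    proof (cases "\<alpha> a \<le> \<mu> b")
      case True
      let ?\<mu> = "\<mu>(b := \<mu> b - \<alpha> a)"
      have "sum ?\<mu> B = sum \<mu> B - \<alpha> a"
        using b(1) less.prems(2) by (simp add: sum.remove)
      then have "\<exists>\<gamma>. coupling (A - {a}) B \<alpha> ?\<mu> \<gamma> \<and> staircase f g {z. \<gamma> z \<noteq> 0}"
        using less.prems True a(1) card_Diff1_less[of A a]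
        by (intro less.hyps) (auto simp: sum_diff1)
      then obtain \<gamma> where \<gamma>: "coupling (A - {a}) B \<alpha> ?\<mu> \<gamma>" "staircase f g {z. \<gamma> z \<noteq> 0}" by blast
      have "coupling A B \<alpha> \<mu> (\<gamma>((a, b) := \<alpha> a))"
        using coupling_add_top[OF less.prems(1,2) a(1) b(1) \<gamma>(1)] less.prems(3) a(1) by blast
      moreover have "staircase f g (insert (a, b) {z. \<gamma> z \<noteq> 0})"
        by (rule staircase_insert_top[OF \<gamma>(2)]) (use couplingD(3,4)[OF \<gamma>(1)] a(2) b(2) in auto)
      then have "staircase f g {z. (\<gamma>((a, b) := \<alpha> a)) z \<noteq> 0}"
        by (rule staircase_subset) auto
      ultimately show ?thesis by blast
    next
      case False
      let ?\<alpha> = "\<alpha>(a := \<alpha> a - \<mu> b)"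
      have "sum ?\<alpha> A = sum \<alpha> A - \<mu> b"
        using a(1) less.prems(1) by (simp add: sum.remove)
      then have "\<exists>\<gamma>. coupling A (B - {b}) ?\<alpha> \<mu> \<gamma> \<and> staircase f g {z. \<gamma> z \<noteq> 0}"
        using less.prems False b(1) card_Diff1_less[of B b]
        by (intro less.hyps) (auto simp: sum_diff1)
      then obtain \<gamma> where \<gamma>: "coupling A (B - {b}) ?\<alpha> \<mu> \<gamma>" "staircase f g {z. \<gamma> z \<noteq> 0}" by blast
      \<comment> \<open>Transposing turns the removal of a column into the removal of a row, so the
        same move applies; \<gamma>' is the updated transpose, transposed back.\<close>
      define \<gamma>' where "\<gamma>' = (\<lambda>(p, w). ((\<lambda>(w, p). \<gamma> (p, w))((b, a) := \<mu> b)) (w, p))"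
      have "coupling B A \<mu> \<alpha> ((\<lambda>(w, p). \<gamma> (p, w))((b, a) := \<mu> b))"
        using coupling_add_top[OF less.prems(2,1) b(1) a(1) coupling_swap[OF \<gamma>(1)]]
          less.prems(4) b(1) by blast
      then have "coupling A B \<alpha> \<mu> \<gamma>'" unfolding \<gamma>'_def by (rule coupling_swap)
      moreover have "staircase f g (insert (a, b) {z. \<gamma> z \<noteq> 0})"
        by (rule staircase_insert_top[OF \<gamma>(2)]) (use couplingD(3,4)[OF \<gamma>(1)] a(2) b(2) in auto)
      then have "staircase f g {z. \<gamma>' z \<noteq> 0}"
        by (rule staircase_subset) (auto simp: \<gamma>'_def split: if_splits)
      ultimately show ?thesis by blast
    qed
  qed
qed

text \<open>
  A staircase has no mass strictly north-west or no mass strictly south-east of a given cell, so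
  the cumulative mass of a coupling supported on it is the minimum of the two cumulative marginals.
\<close>

lemma staircase_coupling_cumulative:
  assumes fin: "finite A" "finite B" and \<gamma>: "coupling A B \<alpha> \<mu> \<gamma>"
    and st: "staircase f g {z. \<gamma> z \<noteq> 0}"
  shows "(\<Sum>z\<in>{p\<in>A. f p \<le> i} \<times> {w\<in>B. g w \<le> j}. \<gamma> z)
       = min (\<Sum>p\<in>{p\<in>A. f p \<le> i}. \<alpha> p) (\<Sum>w\<in>{w\<in>B. g w \<le> j}. \<mu> w)"
proof -
  let ?A = "{p\<in>A. f p \<le> i}" and ?B = "{w\<in>B. g w \<le> j}"
  have nonneg: "\<And>z. 0 \<le> \<gamma> z" using couplingD(1)[OF \<gamma>] .
  have \<alpha>: "(\<Sum>p\<in>?A. \<alpha> p) = (\<Sum>z\<in>?A \<times> B. \<gamma> z)"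
    using \<gamma> by (simp add: coupling_def sum.cartesian_product')
  have \<mu>: "(\<Sum>w\<in>?B. \<mu> w) = (\<Sum>z\<in>A \<times> ?B. \<gamma> z)"
  proof -
    have "(\<Sum>w\<in>?B. \<mu> w) = (\<Sum>w\<in>?B. \<Sum>p\<in>A. \<gamma> (p, w))" using \<gamma> by (simp add: coupling_def)
    also have "\<dots> = (\<Sum>p\<in>A. \<Sum>w\<in>?B. \<gamma> (p, w))" by (rule sum.swap)
    finally show ?thesis by (simp add: sum.cartesian_product')
  qed
  have le: "(\<Sum>z\<in>?A \<times> ?B. \<gamma> z) \<le> (\<Sum>z\<in>?A \<times> B. \<gamma> z)" "(\<Sum>z\<in>?A \<times> ?B. \<gamma> z) \<le> (\<Sum>z\<in>A \<times> ?B. \<gamma> z)"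
    using fin nonneg by (auto intro!: sum_mono2)
  have "(\<Sum>z\<in>?A \<times> ?B. \<gamma> z) = (\<Sum>z\<in>?A \<times> B. \<gamma> z) \<or> (\<Sum>z\<in>?A \<times> ?B. \<gamma> z) = (\<Sum>z\<in>A \<times> ?B. \<gamma> z)"
  proof (rule ccontr)
    assume neg: "\<not> ?thesis"
    have "\<exists>z\<in>?A \<times> B - ?A \<times> ?B. \<gamma> z \<noteq> 0"
    proof (rule ccontr)
      assume "\<not> ?thesis"
      then have "sum \<gamma> (?A \<times> ?B) = sum \<gamma> (?A \<times> B)"
        using fin by (intro sum.mono_neutral_left) auto
      then show False using neg by simp
    qed
    then obtain p1 w1 where 1: "f p1 \<le> i" "\<not> g w1 \<le> j" "\<gamma> (p1, w1) \<noteq> 0" by auto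
    have "\<exists>z\<in>A \<times> ?B - ?A \<times> ?B. \<gamma> z \<noteq> 0"
    proof (rule ccontr)
      assume "\<not> ?thesis"
      then have "sum \<gamma> (?A \<times> ?B) = sum \<gamma> (A \<times> ?B)"
        using fin by (intro sum.mono_neutral_left) auto
      then show False using neg by simp
    qed
    then obtain p2 w2 where 2: "\<not> f p2 \<le> i" "g w2 \<le> j" "\<gamma> (p2, w2) \<noteq> 0" by auto
    \<comment> \<open>Row \<open>p1\<close> is below row \<open>p2\<close>, while column
      \<open>w1\<close> is above column \<open>w2\<close>: two cells of the support would be
      incomparable.\<close>
    show False using staircaseD[OF st, of p1 w1 p2 w2] 1 2 by auto
  qed
  then show ?thesis using le \<alpha> \<mu> by linarith
qed

text \<open>The cumulative masses are determined by the marginals; single cells are recovered from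
  them by induction on the rank sum, which injectivity makes strictly smaller at all other cells of
  the rectangle.\<close>

lemma staircase_coupling_unique:
  assumes fin: "finite A" "finite B" and inj: "inj_on f A" "inj_on g B"
    and \<gamma>: "coupling A B \<alpha> \<mu> \<gamma>" "staircase f g {z. \<gamma> z \<noteq> 0}"
    and \<gamma>': "coupling A B \<alpha> \<mu> \<gamma>'" "staircase f g {z. \<gamma>' z \<noteq> 0}"
  shows "\<gamma> = \<gamma>'"
proof -
  have eq: "\<gamma> (p, w) = \<gamma>' (p, w)" if "p \<in> A" "w \<in> B" for p w
    using that
  proof (induction "f p + g w" arbitrary: p w rule: less_induct)
    case less
    let ?D = "{p'\<in>A. f p' \<le> f p} \<times> {w'\<in>B. g w' \<le> g w}"
    have "sum \<gamma> ?D = sum \<gamma>' ?D"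
      using staircase_coupling_cumulative[OF fin \<gamma>] staircase_coupling_cumulative[OF fin \<gamma>'] by simp
    moreover have "sum \<gamma> (?D - {(p, w)}) = sum \<gamma>' (?D - {(p, w)})"
    proof (rule sum.cong[OF refl])
      fix z assume z: "z \<in> ?D - {(p, w)}"
      then obtain p' w' where zz: "z = (p', w')" "p' \<in> A" "w' \<in> B" "f p' \<le> f p" "g w' \<le> g w"
        "p' \<noteq> p \<or> w' \<noteq> w" by auto
      then have "f p' \<noteq> f p \<or> g w' \<noteq> g w" using inj less.prems by (auto dest: inj_onD)
      then have "f p' + g w' < f p + g w" using zz by linarith
      then show "\<gamma> z = \<gamma>' z" using less.hyps zz by blast
    qed
    moreover have "finite ?D" "(p, w) \<in> ?D" using fin less.prems by auto
    ultimately show ?case by (simp add: sum.remove)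
  qed
  show ?thesis
  proof
    fix z show "\<gamma> z = \<gamma>' z"
      using eq[of "fst z" "snd z"] couplingD(2)[OF \<gamma>(1)] couplingD(2)[OF \<gamma>'(1)]
      by (cases "z \<in> A \<times> B") auto
  qed
qed

section \<open>Subdivision of a product along a colouring\<close>

lemma extreme_point_of_Times:
  assumes "p extreme_point_of P" "w extreme_point_of Q"
  shows "(p, w) extreme_point_of (P \<times> Q)"
  unfolding extreme_point_of_def
proof (intro conjI ballI notI)
  show "(p, w) \<in> P \<times> Q" using assms by (simp add: extreme_point_of_def)
  fix x y assume xy: "x \<in> P \<times> Q" "y \<in> P \<times> Q" "(p, w) \<in> open_segment x y"
  then obtain t where t: "x \<noteq> y" "0 < t" "t < 1" "(p, w) = (1 - t) *\<^sub>R x + t *\<^sub>R y"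
    using in_segment(2) by blast
  have "p = (1 - t) *\<^sub>R fst x + t *\<^sub>R fst y" "w = (1 - t) *\<^sub>R snd x + t *\<^sub>R snd y"
    using t(4) by (metis fst_conv fst_add fst_scaleR, metis snd_conv snd_add snd_scaleR)
  then have "fst x \<noteq> fst y \<Longrightarrow> p \<in> open_segment (fst x) (fst y)"
    "snd x \<noteq> snd y \<Longrightarrow> w \<in> open_segment (snd x) (snd y)"
    using t(2,3) in_segment(2) by blast+
  then show False using assms xy t(1) by (auto simp: extreme_point_of_def prod_eq_iff)
qed

lemma extreme_point_of_TimesD:
  assumes "(p, w) extreme_point_of (P \<times> Q)"
  shows "p extreme_point_of P" "w extreme_point_of Q"
proof -
  have "(p, w) \<in> open_segment (a, w) (b, w)" if "p \<in> open_segment a b" for a b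
    using that by (auto simp: in_segment simp flip: scaleR_add_left)
  then show "p extreme_point_of P" using assms unfolding extreme_point_of_def by blast
  have "(p, w) \<in> open_segment (p, a) (p, b)" if "w \<in> open_segment a b" for a b
    using that by (auto simp: in_segment simp flip: scaleR_add_left)
  then show "w extreme_point_of Q" using assms unfolding extreme_point_of_def by blast
qed

text \<open>The simplices, of all dimensions, in the cell of \<tau> and \<sigma>. The cell is the
  join over the colours \<open>u\<close> of products of two faces, spanned by the vertices of \<tau>
  over \<open>u\<close> and by the vertices of \<sigma> of colour \<open>u\<close>; in each product
  the vertices must form a chain.\<close>

definition coloured_staircases ::
    "('a \<Rightarrow> nat) \<Rightarrow> ('c \<Rightarrow> nat) \<Rightarrow> ('c \<Rightarrow> 'b) \<Rightarrow> ('a \<times> 'b) set \<Rightarrow> 'c set \<Rightarrow> ('a \<times> 'c) set set" where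
  "coloured_staircases f g c \<tau> \<sigma> = {S. snd ` S \<subseteq> \<sigma> \<and> (\<lambda>(p, w). (p, c w)) ` S \<subseteq> \<tau> \<and>
     (\<forall>u. staircase f g {z\<in>S. c (snd z) = u})}"

text \<open>\<open>P\<close> and \<open>Q\<close> are to be the two cubes and \<open>U\<close> the
  vertex set of the simplex factor. \<open>f\<close> and \<open>g\<close> are arbitrary fixed
  orders, shared by all cells so that neighbouring staircases fit together.\<close>

locale coloured_product =
  fixes P :: "'a::real_vector set" and Q :: "'c::real_vector set" and U :: "'b::real_vector set"
    and T0 :: "('a \<times> 'b) set set" and TQ :: "'c set set"
    and c :: "'c \<Rightarrow> 'b" and f :: "'a \<Rightarrow> nat" and g :: "'c \<Rightarrow> nat"
  assumes convex_P: "convex P" and convex_Q: "convex Q"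
    and finite_U: "finite U" and indep_U: "\<not> affine_dependent U"
    and T0: "simplicial_cover T0 (P \<times> (convex hull U))" and TQ: "simplicial_cover TQ Q"
    and colour: "w \<in> \<Union>TQ \<Longrightarrow> c w \<in> U"
    and inj_f: "inj_on f (fst ` \<Union>T0)" and inj_g: "inj_on g (\<Union>TQ)"
begin

abbreviation "VP \<equiv> fst ` \<Union>T0"
abbreviation "VQ \<equiv> \<Union>TQ"
abbreviation "VQc u \<equiv> {w\<in>VQ. c w = u}"

definition product_complex :: "('a \<times> 'c) set set" where
  "product_complex = (\<Union>\<sigma>\<in>TQ. \<Union>\<tau>\<in>T0. coloured_staircases f g c \<tau> \<sigma>)"

lemma product_complex_iff:
  "S \<in> product_complex \<longleftrightarrow> (\<exists>\<sigma>\<in>TQ. snd ` S \<subseteq> \<sigma>) \<and> (\<exists>\<tau>\<in>T0. (\<lambda>(p, w). (p, c w)) ` S \<subseteq> \<tau>) \<and>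
     (\<forall>u. staircase f g {z\<in>S. c (snd z) = u})"
  unfolding product_complex_def coloured_staircases_def by blast

lemma finite_VP: "finite VP" and finite_VQ: "finite VQ"
  using simplicial_coverD(1,2)[OF T0] simplicial_coverD(1,2)[OF TQ] by auto

lemma finite_VQc: "finite (VQc u)"
  by (rule finite_subset[OF _ finite_VQ]) auto

lemma T0_vertex:
  assumes "(p, u) \<in> \<Union>T0"
  shows "p extreme_point_of P" "p \<in> VP" "u \<in> U"
proof -
  have "(p, u) extreme_point_of (P \<times> (convex hull U))"
    using assms simplicial_coverD(3)[OF T0] by blast
  then show "p extreme_point_of P" "u \<in> U"
    using extreme_point_of_TimesD extreme_point_of_convex_hull by blast+
  show "p \<in> VP" using assms by (metis fst_conv image_eqI)
qed

lemma T0_subset: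
  assumes "\<tau> \<in> T0"
  shows "\<tau> \<subseteq> VP \<times> U"
proof (rule subrelI)
  fix p u assume "(p, u) \<in> \<tau>"
  then have "(p, u) \<in> \<Union>T0" using assms by (rule UnionI[rotated])
  then show "(p, u) \<in> VP \<times> U" using T0_vertex(2,3) by (intro SigmaI)
qed

lemma product_complexD:
  assumes "S \<in> product_complex" "(p, w) \<in> S"
  shows "w \<in> VQ" "(p, c w) \<in> \<Union>T0"
proof -
  obtain \<sigma> where "\<sigma> \<in> TQ" "snd ` S \<subseteq> \<sigma>"
    using assms(1) unfolding product_complex_iff by blast
  then show "w \<in> VQ" using imageI[OF assms(2), of snd] by (metis UnionI snd_conv subsetD)
  obtain \<tau> where "\<tau> \<in> T0" "(\<lambda>(p, w). (p, c w)) ` S \<subseteq> \<tau>"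
    using assms(1) unfolding product_complex_iff by blast
  then show "(p, c w) \<in> \<Union>T0"
    using imageI[OF assms(2), of "\<lambda>(p, w). (p, c w)"] by (metis UnionI case_prod_conv subsetD)
qed

lemma product_complex_subset:
  assumes "S \<in> product_complex"
  shows "S \<subseteq> VP \<times> VQ"
proof (rule subrelI)
  fix p w assume "(p, w) \<in> S"
  then show "(p, w) \<in> VP \<times> VQ"
    using T0_vertex(2)[OF product_complexD(2)[OF assms]] product_complexD(1)[OF assms] by blast
qed

text \<open>\<gamma> is pushed forward along \<open>(p, w) -> w\<close> to coordinates in
  \<open>Q\<close>, and by \<open>colour_marginal\<close> along \<open>(p, w) -> (p, c w)\<close> to
  coordinates in \<open>P\<close> times the simplex.\<close>

definition marginal :: "('a \<times> 'c \<Rightarrow> real) \<Rightarrow> 'c \<Rightarrow> real" where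
  "marginal \<gamma> w = (\<Sum>p\<in>VP. \<gamma> (p, w))"

definition colour_marginal :: "('a \<times> 'c \<Rightarrow> real) \<Rightarrow> 'a \<times> 'b \<Rightarrow> real" where
  "colour_marginal \<gamma> z = (\<Sum>w\<in>VQc (snd z). \<gamma> (fst z, w))"

lemma sum_colour_classes:
  "(\<Sum>u\<in>U. \<Sum>w\<in>VQc u. F w) = (\<Sum>w\<in>VQ. F w :: 'd::comm_monoid_add)"
  using sum.group[OF finite_VQ finite_U, of c F] colour by blast

text \<open>The simplex component depends on \<gamma> only through \<open>marginal\<close>; hence
  coordinates in \<open>Q\<close> fix the point of the simplex at which \<open>T0\<close> is
  consulted.\<close>

lemma colour_marginal_barycentre:
  assumes \<tau>: "\<tau> \<in> T0" and supp: "\<And>z. z \<notin> \<tau> \<Longrightarrow> colour_marginal \<gamma> z = 0"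
  shows "barycentre \<tau> (colour_marginal \<gamma>)
       = (\<Sum>p\<in>VP. \<Sum>w\<in>VQ. \<gamma> (p, w) *\<^sub>R p, \<Sum>w\<in>VQ. marginal \<gamma> w *\<^sub>R c w)"
    and "sum (colour_marginal \<gamma>) \<tau> = (\<Sum>p\<in>VP. \<Sum>w\<in>VQ. \<gamma> (p, w))"
proof -
  have fin: "finite (VP \<times> U)" using finite_VP finite_U by simp
  have "barycentre \<tau> (colour_marginal \<gamma>) = (\<Sum>z\<in>VP \<times> U. colour_marginal \<gamma> z *\<^sub>R z)"
    unfolding barycentre_def
    using T0_subset[OF \<tau>] supp fin by (intro sum.mono_neutral_left) auto
  also have "\<dots> = (\<Sum>p\<in>VP. \<Sum>u\<in>U. \<Sum>w\<in>VQc u. \<gamma> (p, w) *\<^sub>R (p, c w))"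
    unfolding sum.cartesian_product' by (simp add: colour_marginal_def scaleR_sum_left scaleR_Pair sum_prod)
  also have "\<dots> = (\<Sum>p\<in>VP. \<Sum>w\<in>VQ. (\<gamma> (p, w) *\<^sub>R p, \<gamma> (p, w) *\<^sub>R c w))"
    by (simp only: sum_colour_classes scaleR_Pair)
  also have "\<dots> = (\<Sum>p\<in>VP. \<Sum>w\<in>VQ. \<gamma> (p, w) *\<^sub>R p, \<Sum>p\<in>VP. \<Sum>w\<in>VQ. \<gamma> (p, w) *\<^sub>R c w)"
    by (simp add: sum_prod)
  also have "(\<Sum>p\<in>VP. \<Sum>w\<in>VQ. \<gamma> (p, w) *\<^sub>R c w) = (\<Sum>w\<in>VQ. marginal \<gamma> w *\<^sub>R c w)"
    unfolding marginal_def scaleR_sum_left by (rule sum.swap)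
  finally show "barycentre \<tau> (colour_marginal \<gamma>)
       = (\<Sum>p\<in>VP. \<Sum>w\<in>VQ. \<gamma> (p, w) *\<^sub>R p, \<Sum>w\<in>VQ. marginal \<gamma> w *\<^sub>R c w)" .
  have "sum (colour_marginal \<gamma>) \<tau> = (\<Sum>z\<in>VP \<times> U. colour_marginal \<gamma> z)"
    using T0_subset[OF \<tau>] supp fin by (intro sum.mono_neutral_left) auto
  also have "\<dots> = (\<Sum>p\<in>VP. \<Sum>u\<in>U. \<Sum>w\<in>VQc u. \<gamma> (p, w))"
    unfolding sum.cartesian_product' by (simp add: colour_marginal_def)
  finally show "sum (colour_marginal \<gamma>) \<tau> = (\<Sum>p\<in>VP. \<Sum>w\<in>VQ. \<gamma> (p, w))"
    by (simp only: sum_colour_classes)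
qed

lemma marginal_barycentre:
  assumes \<sigma>: "\<sigma> \<in> TQ" and supp: "\<And>w. w \<notin> \<sigma> \<Longrightarrow> marginal \<gamma> w = 0"
  shows "barycentre \<sigma> (marginal \<gamma>) = (\<Sum>p\<in>VP. \<Sum>w\<in>VQ. \<gamma> (p, w) *\<^sub>R w)"
    and "sum (marginal \<gamma>) \<sigma> = (\<Sum>p\<in>VP. \<Sum>w\<in>VQ. \<gamma> (p, w))"
proof -
  have "barycentre \<sigma> (marginal \<gamma>) = (\<Sum>w\<in>VQ. marginal \<gamma> w *\<^sub>R w)"
    unfolding barycentre_def
    using \<sigma> supp finite_VQ by (intro sum.mono_neutral_left) auto
  also have "\<dots> = (\<Sum>p\<in>VP. \<Sum>w\<in>VQ. \<gamma> (p, w) *\<^sub>R w)"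
    unfolding marginal_def scaleR_sum_left by (rule sum.swap)
  finally show "barycentre \<sigma> (marginal \<gamma>) = (\<Sum>p\<in>VP. \<Sum>w\<in>VQ. \<gamma> (p, w) *\<^sub>R w)" .
  have "sum (marginal \<gamma>) \<sigma> = (\<Sum>w\<in>VQ. marginal \<gamma> w)"
    using \<sigma> supp finite_VQ by (intro sum.mono_neutral_left) auto
  also have "\<dots> = (\<Sum>p\<in>VP. \<Sum>w\<in>VQ. \<gamma> (p, w))"
    unfolding marginal_def by (rule sum.swap)
  finally show "sum (marginal \<gamma>) \<sigma> = (\<Sum>p\<in>VP. \<Sum>w\<in>VQ. \<gamma> (p, w))" .
qed

lemma product_barycentre:
  assumes "S \<subseteq> VP \<times> VQ" and supp: "\<And>z. z \<notin> S \<Longrightarrow> \<gamma> z = 0"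
  shows "barycentre S \<gamma> = (\<Sum>p\<in>VP. \<Sum>w\<in>VQ. \<gamma> (p, w) *\<^sub>R p, \<Sum>p\<in>VP. \<Sum>w\<in>VQ. \<gamma> (p, w) *\<^sub>R w)"
    and "sum \<gamma> S = (\<Sum>p\<in>VP. \<Sum>w\<in>VQ. \<gamma> (p, w))"
proof -
  have fin: "finite (VP \<times> VQ)" using finite_VP finite_VQ by simp
  have "barycentre S \<gamma> = (\<Sum>z\<in>VP \<times> VQ. \<gamma> z *\<^sub>R z)"
    unfolding barycentre_def using assms fin by (intro sum.mono_neutral_left) auto
  then show "barycentre S \<gamma> = (\<Sum>p\<in>VP. \<Sum>w\<in>VQ. \<gamma> (p, w) *\<^sub>R p, \<Sum>p\<in>VP. \<Sum>w\<in>VQ. \<gamma> (p, w) *\<^sub>R w)"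
    by (simp add: sum.cartesian_product' scaleR_Pair sum_prod)
  have "sum \<gamma> S = (\<Sum>z\<in>VP \<times> VQ. \<gamma> z)"
    using assms fin by (intro sum.mono_neutral_left) auto
  then show "sum \<gamma> S = (\<Sum>p\<in>VP. \<Sum>w\<in>VQ. \<gamma> (p, w))"
    by (simp add: sum.cartesian_product')
qed

lemma colour_coupling:
  assumes "\<And>z. 0 \<le> \<gamma> z" "\<And>z. z \<notin> VP \<times> VQ \<Longrightarrow> \<gamma> z = 0"
  shows "coupling VP (VQc u) (\<lambda>p. colour_marginal \<gamma> (p, u)) (marginal \<gamma>)
           (\<lambda>z. if c (snd z) = u then \<gamma> z else 0)"
  using assms by (auto simp: coupling_def colour_marginal_def marginal_def)

text \<open>Coordinates in the product complex project to coordinates in \<open>TQ\<close>, and to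
  coordinates in \<open>T0\<close> of the image under the map that keeps \<open>P\<close> and sends
  the vertices of \<sigma> to their colours.\<close>

lemma product_complex_marginals:
  assumes S: "S \<in> product_complex" and \<gamma>: "convex_coeffs S \<gamma>"
  shows "\<exists>\<sigma>\<in>TQ. convex_coeffs \<sigma> (marginal \<gamma>) \<and>
           barycentre \<sigma> (marginal \<gamma>) = snd (barycentre S \<gamma>)" (is ?thesis1)
    and "\<exists>\<tau>\<in>T0. convex_coeffs \<tau> (colour_marginal \<gamma>) \<and> barycentre \<tau> (colour_marginal \<gamma>)
           = (fst (barycentre S \<gamma>), \<Sum>w\<in>VQ. marginal \<gamma> w *\<^sub>R c w)" (is ?thesis2)
proof -
  note sub = product_complex_subset[OF S]
  note bary = product_barycentre[OF sub convex_coeffsD(2)[OF \<gamma>]]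
  have sum1: "(\<Sum>p\<in>VP. \<Sum>w\<in>VQ. \<gamma> (p, w)) = 1"
    using bary(2) convex_coeffsD(3)[OF \<gamma>] by simp
  obtain \<sigma> where \<sigma>: "\<sigma> \<in> TQ" "snd ` S \<subseteq> \<sigma>" using S by (auto simp: product_complex_iff)
  have "(p, w) \<notin> S" if "w \<notin> \<sigma>" for p w using \<sigma>(2) that by force
  then have supp: "marginal \<gamma> w = 0" if "w \<notin> \<sigma>" for w
    using that convex_coeffsD(2)[OF \<gamma>] by (simp add: marginal_def)
  have "convex_coeffs \<sigma> (marginal \<gamma>)"
    unfolding convex_coeffs_def using supp marginal_barycentre(2)[OF \<sigma>(1) supp] sum1
    by (auto simp: marginal_def intro!: sum_nonneg convex_coeffsD(1)[OF \<gamma>])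
  then show ?thesis1
    using \<sigma>(1) marginal_barycentre(1)[OF \<sigma>(1) supp] bary(1) by auto
  obtain \<tau> where \<tau>: "\<tau> \<in> T0" "(\<lambda>(p, w). (p, c w)) ` S \<subseteq> \<tau>"
    using S by (auto simp: product_complex_iff)
  have "(p, w) \<notin> S" if "(p, c w) \<notin> \<tau>" for p w using \<tau>(2) that by force
  then have supp: "colour_marginal \<gamma> z = 0" if "z \<notin> \<tau>" for z
    using that convex_coeffsD(2)[OF \<gamma>] by (cases z) (auto simp: colour_marginal_def)
  have "convex_coeffs \<tau> (colour_marginal \<gamma>)"
    unfolding convex_coeffs_def using supp colour_marginal_barycentre(2)[OF \<tau>(1) supp] sum1
    by (auto simp: colour_marginal_def intro!: sum_nonneg convex_coeffsD(1)[OF \<gamma>])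
  then show ?thesis2
    using \<tau>(1) colour_marginal_barycentre(1)[OF \<tau>(1) supp] bary(1) by auto
qed

text \<open>The coordinates are recovered in three stages: \<open>TQ\<close> determines the
  marginal, which fixes the point of \<open>P\<close> times the simplex; \<open>T0\<close> then
  determines the colour marginal; and in each colour the two marginals admit only one staircase
  coupling.\<close>

lemma product_complex_coeffs_unique:
  assumes S: "S \<in> product_complex" "S' \<in> product_complex"
    and \<gamma>: "convex_coeffs S \<gamma>" and \<gamma>': "convex_coeffs S' \<gamma>'"
    and eq: "barycentre S \<gamma> = barycentre S' \<gamma>'"
  shows "\<gamma> = \<gamma>'"
proof -
  have \<mu>: "marginal \<gamma> = marginal \<gamma>'"
    using product_complex_marginals(1)[OF S(1) \<gamma>] product_complex_marginals(1)[OF S(2) \<gamma>'] eq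
      simplicial_coverD(5)[OF TQ] by metis
  have \<alpha>: "colour_marginal \<gamma> = colour_marginal \<gamma>'"
    using product_complex_marginals(2)[OF S(1) \<gamma>] product_complex_marginals(2)[OF S(2) \<gamma>'] eq \<mu>
      simplicial_coverD(5)[OF T0] by metis
  have zero: "\<delta> z = 0" if "S'' \<in> product_complex" "convex_coeffs S'' \<delta>" "z \<notin> VP \<times> VQ" for S'' \<delta> z
    using product_complex_subset[OF that(1)] convex_coeffsD(2)[OF that(2)] that(3) by blast
  have st: "staircase f g {z. (if c (snd z) = u then \<delta> z else 0) \<noteq> 0}"
    if "S'' \<in> product_complex" "convex_coeffs S'' \<delta>" for S'' \<delta> u
  proof (rule staircase_subset)
    show "staircase f g {z\<in>S''. c (snd z) = u}" using that(1) by (simp add: product_complex_iff)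
    show "{z. (if c (snd z) = u then \<delta> z else 0) \<noteq> 0} \<subseteq> {z\<in>S''. c (snd z) = u}"
      using convex_coeffsD(2)[OF that(2)] by auto
  qed
  show ?thesis
  proof
    fix z :: "'a \<times> 'c"
    let ?u = "c (snd z)"
    have "(\<lambda>z. if c (snd z) = ?u then \<gamma> z else 0) = (\<lambda>z. if c (snd z) = ?u then \<gamma>' z else 0)"
    proof (rule staircase_coupling_unique[of VP "VQc ?u" f g])
      show "coupling VP (VQc ?u) (\<lambda>p. colour_marginal \<gamma> (p, ?u)) (marginal \<gamma>)
           (\<lambda>z. if c (snd z) = ?u then \<gamma> z else 0)"
        using colour_coupling convex_coeffsD(1)[OF \<gamma>] zero[OF S(1) \<gamma>] by blast
      show "coupling VP (VQc ?u) (\<lambda>p. colour_marginal \<gamma> (p, ?u)) (marginal \<gamma>)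
           (\<lambda>z. if c (snd z) = ?u then \<gamma>' z else 0)"
        unfolding \<mu> \<alpha> using colour_coupling convex_coeffsD(1)[OF \<gamma>'] zero[OF S(2) \<gamma>'] by blast
      show "inj_on g (VQc ?u)" by (rule inj_on_subset[OF inj_g]) auto
    qed (use finite_VP finite_VQc inj_f st[OF S(1) \<gamma>] st[OF S(2) \<gamma>'] in auto)
    then show "\<gamma> z = \<gamma>' z" by (auto dest: fun_cong[where x = z])
  qed
qed

text \<open>The same stages in the constructive direction: coordinates \<mu> in \<open>TQ\<close>,
  the image point in the simplex, coordinates \<alpha> in \<open>T0\<close>, and for each colour a
  staircase coupling of \<alpha> and \<mu>.\<close>

lemma product_complex_covers:
  assumes "x \<in> P" "y \<in> Q"
  shows "\<exists>S\<in>product_complex. (x, y) \<in> convex hull S"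
proof -
  obtain \<sigma> where \<sigma>: "\<sigma> \<in> TQ" "y \<in> convex hull \<sigma>"
    using simplicial_coverD(4)[OF TQ] assms(2) by blast
  then obtain \<mu> where \<mu>: "convex_coeffs \<sigma> \<mu>" "barycentre \<sigma> \<mu> = y"
    using in_convex_hull_iff_coeffs simplicial_coverD(2)[OF TQ] by blast
  have \<sigma>VQ: "\<sigma> \<subseteq> VQ" using \<sigma>(1) by blast
  have \<mu>VQ: "convex_coeffs VQ \<mu>" "barycentre VQ \<mu> = y"
    using convex_coeffs_superset[OF \<mu>(1) \<sigma>VQ finite_VQ] \<mu>(2) by auto
  define \<beta> where "\<beta> = (\<lambda>u. \<Sum>w\<in>VQc u. \<mu> w)"
  have \<beta>: "convex_coeffs U \<beta>"
    unfolding convex_coeffs_def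
  proof (intro conjI allI impI)
    show "0 \<le> \<beta> u" for u
      unfolding \<beta>_def by (intro sum_nonneg) (simp add: convex_coeffsD(1)[OF \<mu>(1)])
    show "\<beta> u = 0" if "u \<notin> U" for u
    proof -
      have "VQc u = {}" using that colour by blast
      then show ?thesis by (simp only: \<beta>_def sum.empty)
    qed
    show "sum \<beta> U = 1" unfolding \<beta>_def
      using sum_colour_classes[of \<mu>] convex_coeffsD(3)[OF \<mu>VQ(1)] by simp
  qed
  have "barycentre U \<beta> \<in> convex hull U"
    using \<beta> finite_U in_convex_hull_iff_coeffs by blast
  then obtain \<tau> where \<tau>: "\<tau> \<in> T0" "(x, barycentre U \<beta>) \<in> convex hull \<tau>"
    using simplicial_coverD(4)[OF T0] assms(1) by blast
  then obtain \<alpha> where \<alpha>: "convex_coeffs \<tau> \<alpha>" "barycentre \<tau> \<alpha> = (x, barycentre U \<beta>)"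
    using in_convex_hull_iff_coeffs simplicial_coverD(2)[OF T0] by blast
  have fin: "finite (VP \<times> U)" using finite_VP finite_U by simp
  have \<alpha>V: "convex_coeffs (VP \<times> U) \<alpha>" "barycentre (VP \<times> U) \<alpha> = (x, barycentre U \<beta>)"
    using convex_coeffs_superset[OF \<alpha>(1) T0_subset[OF \<tau>(1)] fin] \<alpha>(2) by auto
  have "(\<Sum>p\<in>VP. \<Sum>u\<in>U. \<alpha> (p, u) *\<^sub>R p, \<Sum>p\<in>VP. \<Sum>u\<in>U. \<alpha> (p, u) *\<^sub>R u) = (x, barycentre U \<beta>)"
    using \<alpha>V(2) by (simp add: barycentre_def sum.cartesian_product' scaleR_Pair sum_prod)
  then have x: "(\<Sum>p\<in>VP. \<Sum>u\<in>U. \<alpha> (p, u) *\<^sub>R p) = x"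
    and bU: "(\<Sum>p\<in>VP. \<Sum>u\<in>U. \<alpha> (p, u) *\<^sub>R u) = barycentre U \<beta>" by auto
  \<comment> \<open>Equality of the masses to be coupled: both sides are coordinates of the same
    point of the simplex with affinely independent vertices \<open>U\<close>.\<close>
  have \<alpha>sum: "(\<Sum>p\<in>VP. \<alpha> (p, u)) = \<beta> u" if u: "u \<in> U" for u
  proof (rule affine_independent_coeffs_unique[OF finite_U indep_U _ _ u])
    have "(\<Sum>u\<in>U. \<Sum>p\<in>VP. \<alpha> (p, u)) = (\<Sum>p\<in>VP. \<Sum>u\<in>U. \<alpha> (p, u))" by (rule sum.swap)
    also have "\<dots> = 1"
      using convex_coeffsD(3)[OF \<alpha>V(1)] by (simp add: sum.cartesian_product')
    finally show "(\<Sum>u\<in>U. \<Sum>p\<in>VP. \<alpha> (p, u)) = sum \<beta> U" using convex_coeffsD(3)[OF \<beta>] by simp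
    show "barycentre U (\<lambda>u. \<Sum>p\<in>VP. \<alpha> (p, u)) = barycentre U \<beta>"
      unfolding bU[symmetric]
      unfolding barycentre_def[of U "\<lambda>u. \<Sum>p\<in>VP. \<alpha> (p, u)"] scaleR_sum_left by (rule sum.swap)
  qed
  have "\<exists>\<gamma>. coupling VP (VQc u) (\<lambda>p. \<alpha> (p, u)) \<mu> \<gamma> \<and> staircase f g {z. \<gamma> z \<noteq> 0}" if "u \<in> U" for u
  proof (rule staircase_coupling_exists[OF finite_VP finite_VQc])
    show "(\<Sum>p\<in>VP. \<alpha> (p, u)) = sum \<mu> (VQc u)" using \<alpha>sum[OF that] by (simp only: \<beta>_def)
  qed (rule convex_coeffsD(1)[OF \<alpha>(1)] convex_coeffsD(1)[OF \<mu>(1)])+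
  then have "\<forall>u\<in>U. \<exists>\<gamma>. coupling VP (VQc u) (\<lambda>p. \<alpha> (p, u)) \<mu> \<gamma> \<and> staircase f g {z. \<gamma> z \<noteq> 0}"
    by blast
  from bchoice[OF this] obtain \<gamma>c where \<gamma>c: "\<And>u. u \<in> U \<Longrightarrow> coupling VP (VQc u) (\<lambda>p. \<alpha> (p, u)) \<mu> (\<gamma>c u)"
      "\<And>u. u \<in> U \<Longrightarrow> staircase f g {z. \<gamma>c u z \<noteq> 0}" by blast
  \<comment> \<open>Every vertex \<open>w\<close> has one colour, so the couplings of different
    colours have disjoint supports and can be glued.\<close>
  define \<gamma> where "\<gamma> = (\<lambda>(p, w). if w \<in> VQ then \<gamma>c (c w) (p, w) else 0)"
  define S where "S = {z. \<gamma> z \<noteq> 0}"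
  have \<gamma>eq: "\<gamma> (p, w) = \<gamma>c u (p, w)" if "w \<in> VQc u" for p w u
    using that by (auto simp: \<gamma>_def)
  have \<gamma>nonneg: "0 \<le> \<gamma> z" for z
    using couplingD(1)[OF \<gamma>c(1)] colour by (cases z) (auto simp: \<gamma>_def)
  have inV: "p \<in> VP \<and> w \<in> VQ" if "(p, w) \<in> S" for p w
  proof -
    have w: "w \<in> VQ" and nz: "\<gamma>c (c w) (p, w) \<noteq> 0"
      using that by (auto simp: S_def \<gamma>_def split: if_splits)
    show ?thesis using couplingD(3)[OF \<gamma>c(1)[OF colour[OF w]] nz] w by blast
  qed
  then have SV: "S \<subseteq> VP \<times> VQ" by fast
  have marg: "marginal \<gamma> w = \<mu> w" for w
  proof (cases "w \<in> VQ")
    case True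
    have "(\<Sum>p\<in>VP. \<gamma> (p, w)) = (\<Sum>p\<in>VP. \<gamma>c (c w) (p, w))" using True by (simp add: \<gamma>_def)
    also have "\<dots> = \<mu> w"
      using \<gamma>c(1)[OF colour[OF True]] True by (auto simp: coupling_def)
    finally show ?thesis by (simp add: marginal_def)
  next
    case False
    then show ?thesis using convex_coeffsD(2)[OF \<mu>VQ(1)] by (simp add: marginal_def \<gamma>_def)
  qed
  have cmarg: "colour_marginal \<gamma> (p, u) = \<alpha> (p, u)" if "p \<in> VP" "u \<in> U" for p u
  proof -
    have "(\<Sum>w\<in>VQc u. \<gamma> (p, w)) = (\<Sum>w\<in>VQc u. \<gamma>c u (p, w))"
      by (rule sum.cong[OF refl]) (rule \<gamma>eq)
    also have "\<dots> = \<alpha> (p, u)" using \<gamma>c(1)[OF that(2)] that(1) by (auto simp: coupling_def)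
    finally show ?thesis by (simp add: colour_marginal_def)
  qed
  \<comment> \<open>Positive mass in a cell forces positive marginals, which places \<open>w\<close>
    in the chosen \<sigma> and \<open>(p, c w)\<close> in the chosen \<tau>.\<close>
  have pos: "\<alpha> (p, c w) \<noteq> 0 \<and> \<mu> w \<noteq> 0" if pw: "(p, w) \<in> S" for p w
  proof -
    have p: "p \<in> VP" and w: "w \<in> VQ" using inV[OF pw] by auto
    have gpos: "0 < \<gamma> (p, w)" using pw \<gamma>nonneg[of "(p, w)"] by (simp add: S_def)
    have "0 < marginal \<gamma> w" unfolding marginal_def
      by (rule sum_pos2[where f = "\<lambda>p. \<gamma> (p, w)", OF finite_VP p gpos]) (rule \<gamma>nonneg)
    moreover have "0 < colour_marginal \<gamma> (p, c w)" unfolding colour_marginal_def fst_conv snd_conv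
      by (rule sum_pos2[where f = "\<lambda>w. \<gamma> (p, w)", OF finite_VQc _ gpos]) (use w \<gamma>nonneg in auto)
    ultimately show ?thesis using marg cmarg[OF p colour[OF w]] by simp
  qed
  have "S \<in> product_complex"
    unfolding product_complex_iff
  proof (intro conjI allI)
    have in\<sigma>: "w \<in> \<sigma>" and in\<tau>: "(p, c w) \<in> \<tau>" if "(p, w) \<in> S" for p w
      using pos[OF that] convex_coeffsD(2)[OF \<mu>(1)] convex_coeffsD(2)[OF \<alpha>(1)] by blast+
    show "\<exists>\<sigma>\<in>TQ. snd ` S \<subseteq> \<sigma>"
      using \<sigma>(1) in\<sigma> by (intro bexI[of _ \<sigma>]) auto
    show "\<exists>\<tau>\<in>T0. (\<lambda>(p, w). (p, c w)) ` S \<subseteq> \<tau>"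
      using \<tau>(1) in\<tau> by (intro bexI[of _ \<tau>]) auto
    show "staircase f g {z \<in> S. c (snd z) = u}" for u
    proof (cases "u \<in> U")
      case True
      show ?thesis
        by (rule staircase_subset[OF \<gamma>c(2)[OF True]]) (auto simp: S_def \<gamma>_def split: if_splits)
    next
      case False
      then have "{z \<in> S. c (snd z) = u} = {}" using inV colour by force
      then show ?thesis by (simp only: staircase_def) simp
    qed
  qed
  moreover have "convex_coeffs S \<gamma> \<and> barycentre S \<gamma> = (x, y)"
  proof -
    have supp: "\<gamma> z = 0" if "z \<notin> S" for z using that by (simp add: S_def)
    note bary = product_barycentre[OF SV supp]
    have rows: "(\<Sum>w\<in>VQ. \<gamma> (p, w)) = (\<Sum>u\<in>U. \<alpha> (p, u))" if "p \<in> VP" for p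
    proof -
      have "(\<Sum>w\<in>VQ. \<gamma> (p, w)) = (\<Sum>u\<in>U. \<Sum>w\<in>VQc u. \<gamma> (p, w))"
        by (simp only: sum_colour_classes)
      also have "\<dots> = (\<Sum>u\<in>U. \<alpha> (p, u))"
        by (rule sum.cong[OF refl]) (use cmarg[OF that] in \<open>simp add: colour_marginal_def\<close>)
      finally show ?thesis .
    qed
    have "(\<Sum>p\<in>VP. \<Sum>w\<in>VQ. \<gamma> (p, w)) = (\<Sum>w\<in>VQ. marginal \<gamma> w)"
      unfolding marginal_def by (rule sum.swap)
    also have "\<dots> = 1" unfolding marg using convex_coeffsD(3)[OF \<mu>VQ(1)] .
    finally have "convex_coeffs S \<gamma>"
      unfolding convex_coeffs_def using \<gamma>nonneg supp bary(2) by simp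
    moreover have "(\<Sum>p\<in>VP. \<Sum>w\<in>VQ. \<gamma> (p, w) *\<^sub>R p) = x"
    proof -
      have "(\<Sum>p\<in>VP. \<Sum>w\<in>VQ. \<gamma> (p, w) *\<^sub>R p) = (\<Sum>p\<in>VP. (\<Sum>u\<in>U. \<alpha> (p, u)) *\<^sub>R p)"
        by (rule sum.cong[OF refl]) (simp only: rows scaleR_sum_left[symmetric])
      then show ?thesis using x by (simp only: scaleR_sum_left)
    qed
    moreover have "(\<Sum>p\<in>VP. \<Sum>w\<in>VQ. \<gamma> (p, w) *\<^sub>R w) = y"
    proof -
      have "(\<Sum>p\<in>VP. \<Sum>w\<in>VQ. \<gamma> (p, w) *\<^sub>R w) = (\<Sum>w\<in>VQ. marginal \<gamma> w *\<^sub>R w)"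
        unfolding marginal_def scaleR_sum_left by (rule sum.swap)
      then show ?thesis using \<mu>VQ(2) by (simp add: marg barycentre_def)
    qed
    ultimately show ?thesis using bary(1) by simp
  qed
  moreover have "finite S" using SV finite_VP finite_VQ by (meson finite_SigmaI finite_subset)
  ultimately show ?thesis using in_convex_hull_iff_coeffs by blast
qed

lemma simplicial_cover_product_complex: "simplicial_cover product_complex (P \<times> Q)"
proof -
  have ext: "S \<subseteq> {z. z extreme_point_of (P \<times> Q)}" if S: "S \<in> product_complex" for S
  proof
    fix z assume z: "z \<in> S"
    obtain p w where pw: "z = (p, w)" by (cases z)
    have "w \<in> VQ" using product_complexD(1)[OF S] z pw by simp
    then have "w extreme_point_of Q" using simplicial_coverD(3)[OF TQ] by blast
    moreover have "(p, c w) \<in> \<Union>T0" using product_complexD(2)[OF S] z pw by simp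
    then have "p extreme_point_of P" by (rule T0_vertex)
    ultimately show "z \<in> {z. z extreme_point_of (P \<times> Q)}"
      using pw extreme_point_of_Times by blast
  qed
  then have sub: "S \<subseteq> P \<times> Q" if "S \<in> product_complex" for S
    using that unfolding extreme_point_of_def by blast
  have "convex (P \<times> Q)" using convex_P convex_Q by (rule convex_Times)
  then have hull: "convex hull S \<subseteq> P \<times> Q" if "S \<in> product_complex" for S
    using sub[OF that] hull_minimal by metis
  have fin: "finite (VP \<times> VQ)" using finite_VP finite_VQ by simp
  show ?thesis
    unfolding simplicial_cover_def
  proof (intro conjI ballI allI impI)
    show "finite product_complex"
      by (rule finite_subset[of _ "Pow (VP \<times> VQ)"]) (use product_complex_subset fin in auto)
    show "finite S" if "S \<in> product_complex" for S
      using product_complex_subset[OF that] fin finite_subset by blast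
    show "\<Union> ((hull) convex ` product_complex) = P \<times> Q"
      using hull product_complex_covers by blast
  qed (use ext product_complex_coeffs_unique in auto)
qed

end

section \<open>Counting staircases and averaging over colourings\<close>

text \<open>A further cell in row \<open>a\<close> and a further cell in column \<open>b\<close>
  would be incomparable; so without the corner a whole row or a whole column is free. This dichotomy
  drives the inductions that bound and count staircases.\<close>

lemma staircase_remove_top:
  assumes S: "S \<subseteq> A \<times> B" "staircase f g S" and inj: "inj_on f A" "inj_on g B"
    and a: "a \<in> A" "\<And>p. p \<in> A \<Longrightarrow> f p \<le> f a" and b: "b \<in> B" "\<And>w. w \<in> B \<Longrightarrow> g w \<le> g b"
  shows "S - {(a, b)} \<subseteq> (A - {a}) \<times> B \<or> S - {(a, b)} \<subseteq> A \<times> (B - {b})"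
proof (rule ccontr)
  assume neg: "\<not> ?thesis"
  from neg obtain p w where 1: "(p, w) \<in> S" "p = a" "w \<noteq> b" using S(1) by blast
  from neg obtain p' w' where 2: "(p', w') \<in> S" "p' \<noteq> a" "w' = b" using S(1) by blast
  have V: "w \<in> B" "p' \<in> A" using 1 2 S(1) by auto
  then have "f p' \<noteq> f a" "g w \<noteq> g b" using inj a(1) b(1) 1 2 by (auto dest: inj_onD)
  then have "f p' < f a" "g w < g b" using a(2) b(2) V by (auto simp: order_less_le)
  then show False using staircaseD[OF S(2) 1(1) 2(1)] 1 2 by auto
qed

lemma obtain_maximal:
  assumes "finite A" "A \<noteq> {}"
  obtains a where "a \<in> A" "\<And>p. p \<in> A \<Longrightarrow> (f p :: nat) \<le> f a"
proof -
  have "Max (f ` A) \<in> f ` A" using assms by (intro Max_in) auto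
  then obtain a where "a \<in> A" "f a = Max (f ` A)" by auto
  then show thesis using that assms(1) by simp
qed

text \<open>Removing the corner and then a free row or column costs at most one cell.
  \<open>B\<close> may be empty, because a colour need not occur in a simplex of the second
  factor.\<close>

lemma card_staircase_le:
  assumes "finite A" "finite B" "A \<noteq> {}" "inj_on f A" "inj_on g B" "S \<subseteq> A \<times> B" "staircase f g S"
  shows "card S + 1 \<le> card A + card B"
  using assms
proof (induction "card A + card B" arbitrary: A B S rule: less_induct)
  case less
  note prems = less.prems
  have finS: "finite S" using prems by (meson finite_SigmaI finite_subset)
  show ?case
  proof (cases "B = {}")
    case True
    then show ?thesis using prems by (simp add: Suc_le_eq card_gt_0_iff)
  next
    case False
    obtain a where a: "a \<in> A" "\<And>p. p \<in> A \<Longrightarrow> f p \<le> f a" using obtain_maximal prems(1,3) by blast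
    obtain b where b: "b \<in> B" "\<And>w. w \<in> B \<Longrightarrow> g w \<le> g b" using obtain_maximal prems(2) False by blast
    let ?S = "S - {(a, b)}"
    have st: "staircase f g ?S" using staircase_subset[OF prems(7)] by blast
    have cA: "card (A - {a}) = card A - 1" "card A > 0" using a(1) prems(1) by (auto simp: card_gt_0_iff)
    have cB: "card (B - {b}) = card B - 1" "card B > 0" using b(1) prems(2) by (auto simp: card_gt_0_iff)
    have "card ?S + 2 \<le> card A + card B"
    proof -
      consider "A = {a}" "?S \<subseteq> (A - {a}) \<times> B" | "A - {a} \<noteq> {}" "?S \<subseteq> (A - {a}) \<times> B"
        | "?S \<subseteq> A \<times> (B - {b})"
        using staircase_remove_top[OF prems(6,7,4,5) a b] a(1) by blast
      then show ?thesis
      proof cases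
        case 1
        \<comment> \<open>Removing the only row would violate the nonemptiness required by the
          induction hypothesis, but it leaves no cell at all.\<close>
        then have "?S = {}" by simp
        then show ?thesis using cA cB by (simp only: card.empty)
      next
        case 2
        then have "card ?S + 1 \<le> card (A - {a}) + card B"
          using prems st cA cB inj_on_subset[OF prems(4)] by (intro less.hyps) auto
        then show ?thesis using cA cB by linarith
      next
        case 3
        then have "card ?S + 1 \<le> card A + card (B - {b})"
          using prems st cA cB inj_on_subset[OF prems(5)] by (intro less.hyps) auto
        then show ?thesis using cA cB by linarith
      qed
    qed
    moreover have "card S \<le> card ?S + 1"
      by (cases "(a, b) \<in> S") (use card_Suc_Diff1[OF finS, of "(a, b)"] in simp_all)
    ultimately show ?thesis by linarith
  qed
qed

text \<open>For injective rankings and nonempty sets these are the monotone lattice paths joining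
  opposite corners, the maximal simplices of the staircase triangulation.\<close>

definition staircase_paths :: "('a \<Rightarrow> nat) \<Rightarrow> ('c \<Rightarrow> nat) \<Rightarrow> 'a set \<Rightarrow> 'c set \<Rightarrow> ('a \<times> 'c) set set" where
  "staircase_paths f g A B = {S. S \<subseteq> A \<times> B \<and> staircase f g S \<and> card S + 1 = card A + card B}"

lemma finite_staircase_paths:
  assumes "finite A" "finite B"
  shows "finite (staircase_paths f g A B)"
  by (rule finite_subset[of _ "Pow (A \<times> B)"]) (use assms in \<open>auto simp: staircase_paths_def\<close>)

text \<open>The number of multisets of size \<open>t\<close> from \<open>k\<close> kinds. For
  \<open>k = 0\<close> it is 0 when \<open>t > 0\<close> and 1 when \<open>t = 0\<close>, which
  matches the count of paths with an empty column set.\<close>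

definition multichoose :: "nat \<Rightarrow> nat \<Rightarrow> real" where
  "multichoose k t = pochhammer (real k) t / fact t"

lemma multichoose_nonneg: "0 \<le> multichoose k t"
  unfolding multichoose_def pochhammer_prod
  by (intro divide_nonneg_nonneg prod_nonneg) auto

lemma multichoose_Suc_Suc:
  "multichoose (Suc k) (Suc t) = multichoose (Suc k) t + multichoose k (Suc t)"
proof -
  have "pochhammer (real (Suc k)) (Suc t) = pochhammer (real (Suc k)) t * (real (Suc k) + real t)"
    by (simp add: pochhammer_Suc)
  moreover have "pochhammer (real k) (Suc t) = real k * pochhammer (real (Suc k)) t"
    by (simp add: pochhammer_rec add.commute)
  ultimately show ?thesis
    by (simp add: multichoose_def field_simps del: of_nat_Suc) (simp add: algebra_simps)
qed

text \<open>A maximal path contains the top corner, and its rest is a maximal path with one row or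
  one column less; this is the recursion of \<open>multichoose\<close>.\<close>

lemma card_staircase_paths_le:
  assumes "finite A" "finite B" "A \<noteq> {}" "inj_on f A" "inj_on g B"
  shows "real (card (staircase_paths f g A B)) \<le> multichoose (card B) (card A - 1)"
  using assms
proof (induction "card A + card B" arbitrary: A B rule: less_induct)
  case less
  note prems = less.prems
  obtain a where a: "a \<in> A" "\<And>p. p \<in> A \<Longrightarrow> f p \<le> f a" using obtain_maximal prems(1,3) by blast
  have cA: "card (A - {a}) = card A - 1" "card A > 0" using a(1) prems(1) by (auto simp: card_gt_0_iff)
  show ?case
  proof (cases "A = {a}")
    case True
    have "S = A \<times> B" if "S \<in> staircase_paths f g A B" for S
      using that True prems by (intro card_subset_eq) (auto simp: staircase_paths_def card_cartesian_product)
    then have "staircase_paths f g A B \<subseteq> {A \<times> B}" by blast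
    then have "card (staircase_paths f g A B) \<le> 1"
      using card_mono[of "{A \<times> B}"] by fastforce
    then show ?thesis using True by (simp add: multichoose_def)
  next
    case False
    then have "A - {a} \<noteq> {}" using a(1) by blast
    then have "card (A - {a}) > 0" using prems(1) by (simp add: card_gt_0_iff)
    then obtain t where t: "card A = Suc (Suc t)"
      using cA by (metis Suc_pred' gr0_conv_Suc)
    show ?thesis
    proof (cases "B = {}")
      case True
      then have "staircase_paths f g A B = {}" using t by (auto simp: staircase_paths_def)
      then show ?thesis by (simp add: multichoose_nonneg)
    next
      case False
      obtain b where b: "b \<in> B" "\<And>w. w \<in> B \<Longrightarrow> g w \<le> g b" using obtain_maximal prems(2) False by blast
      have cB: "card (B - {b}) = card B - 1" "card B > 0" using b(1) prems(2) by (auto simp: card_gt_0_iff)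
      then obtain k where k: "card B = Suc k" using gr0_conv_Suc by blast
      let ?X = "staircase_paths f g (A - {a}) B" and ?Y = "staircase_paths f g A (B - {b})"
      have "staircase_paths f g A B \<subseteq> insert (a, b) ` (?X \<union> ?Y)"
      proof
        fix S assume "S \<in> staircase_paths f g A B"
        then have S: "S \<subseteq> A \<times> B" "staircase f g S" "card S + 1 = card A + card B"
          by (auto simp: staircase_paths_def)
        have finS: "finite S" using S(1) prems by (meson finite_SigmaI finite_subset)
        let ?S = "S - {(a, b)}"
        have st: "staircase f g ?S" using staircase_subset[OF S(2)] by blast
        have sub: "?S \<subseteq> (A - {a}) \<times> B \<or> ?S \<subseteq> A \<times> (B - {b})"
          by (rule staircase_remove_top[OF S(1,2) prems(4,5) a b])
        have "card ?S + 2 \<le> card A + card B"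
        proof (cases "?S \<subseteq> (A - {a}) \<times> B")
          case True
          then have "card ?S + 1 \<le> card (A - {a}) + card B"
            using prems st \<open>A - {a} \<noteq> {}\<close> inj_on_subset[OF prems(4)] by (intro card_staircase_le) auto
          then show ?thesis using cA by linarith
        next
          case False
          then have "card ?S + 1 \<le> card A + card (B - {b})"
            using sub prems st inj_on_subset[OF prems(5)] by (intro card_staircase_le) auto
          then show ?thesis using cB by linarith
        qed
        \<comment> \<open>Without the corner at most \<open>card A + card B - 2\<close> cells
          remain, one fewer than a maximal path has.\<close>
        then have "(a, b) \<in> S" using S(3) by (cases "(a, b) \<in> S") auto
        then have *: "card ?S + 1 = card S" "S = insert (a, b) ?S"
          using card_Suc_Diff1[OF finS, of "(a, b)"] by (simp, blast)
        have "?S \<in> ?X \<or> ?S \<in> ?Y"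
          unfolding staircase_paths_def using sub st S(3) cA cB *(1) by auto
        then have "?S \<in> ?X \<union> ?Y" by blast
        then show "S \<in> insert (a, b) ` (?X \<union> ?Y)" by (rule image_eqI[where x = ?S and f = "insert (a, b)", OF *(2)])
      qed
      moreover have fin: "finite ?X" "finite ?Y" using prems by (auto intro!: finite_staircase_paths)
      ultimately have "card (staircase_paths f g A B) \<le> card (?X \<union> ?Y)"
        by (intro surj_card_le) auto
      also have "\<dots> \<le> card ?X + card ?Y" by (rule card_Un_le)
      finally have "real (card (staircase_paths f g A B)) \<le> real (card ?X) + real (card ?Y)"
        by (metis of_nat_add of_nat_mono)
      also have "real (card ?X) \<le> multichoose (card B) (card (A - {a}) - 1)"
        using prems \<open>A - {a} \<noteq> {}\<close> cA inj_on_subset[OF prems(4)] by (intro less.hyps) auto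
      also have "real (card ?Y) \<le> multichoose (card (B - {b})) (card A - 1)"
        using prems cB inj_on_subset[OF prems(5)] by (intro less.hyps) auto
      finally show ?thesis using t k cA cB by (simp add: multichoose_Suc_Suc)
    qed
  qed
qed

section \<open>Simplices over one pair of simplices\<close>

lemma card_fibre: "card {p. (p, u) \<in> \<tau>} = card {z\<in>\<tau>. snd z = u}"
  by (rule bij_betw_same_card[of "\<lambda>p. (p, u)"]) (auto simp: bij_betw_def inj_on_def)

locale coloured_pair =
  fixes f :: "'a \<Rightarrow> nat" and g :: "'c \<Rightarrow> nat" and c :: "'c \<Rightarrow> 'b" and U :: "'b set"
    and \<tau> :: "('a \<times> 'b) set" and \<sigma> :: "'c set"
  assumes fin: "finite \<tau>" "finite \<sigma>" "finite U"
    and inj: "inj_on f (fst ` \<tau>)" "inj_on g \<sigma>"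
    and col: "c ` \<sigma> \<subseteq> U" "snd ` \<tau> \<subseteq> U"
    and fibre: "\<And>u. u \<in> U \<Longrightarrow> {p. (p, u) \<in> \<tau>} \<noteq> {}"
begin

abbreviation "A u \<equiv> {p. (p, u) \<in> \<tau>}"
abbreviation "B u \<equiv> {w\<in>\<sigma>. c w = u}"

lemma fin_AB: "finite (A u)" "finite (B u)"
proof -
  have "A u \<subseteq> fst ` \<tau>" by force
  then show "finite (A u)" using fin(1) finite_subset by blast
  show "finite (B u)" using fin(2) by simp
qed

lemma inj_AB: "inj_on f (A u)" "inj_on g (B u)"
  using inj by (auto intro: inj_on_subset) (force intro: inj_on_subset)

lemma card_\<sigma>: "(\<Sum>u\<in>U. card (B u)) = card \<sigma>"
  using sum.group[OF fin(2,3) col(1), of "\<lambda>_. 1::nat"] by simp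

lemma card_\<tau>: "(\<Sum>u\<in>U. card (A u)) = card \<tau>"
  unfolding card_fibre using sum.group[OF fin(1,3) col(2), of "\<lambda>_. 1::nat"] by simp

lemma layer:
  assumes "S \<in> coloured_staircases f g c \<tau> \<sigma>"
  shows "{z\<in>S. c (snd z) = u} \<subseteq> A u \<times> B u" "staircase f g {z\<in>S. c (snd z) = u}"
  using assms unfolding coloured_staircases_def by auto

lemma card_layers:
  assumes "S \<in> coloured_staircases f g c \<tau> \<sigma>"
  shows "(\<Sum>u\<in>U. card {z\<in>S. c (snd z) = u}) = card S"
proof -
  have *: "S \<subseteq> fst ` \<tau> \<times> \<sigma>" using assms unfolding coloured_staircases_def by force
  then have "finite S" using fin by (meson finite_SigmaI finite_imageI finite_subset)
  then show ?thesis
    using sum.group[of S U "\<lambda>z. c (snd z)" "\<lambda>_. 1::nat"] fin(3) col(1) * by fastforce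
qed

lemma card_layer_le:
  assumes "S \<in> coloured_staircases f g c \<tau> \<sigma>" "u \<in> U"
  shows "card {z\<in>S. c (snd z) = u} + 1 \<le> card (A u) + card (B u)"
  using card_staircase_le[OF fin_AB fibre[OF assms(2)] inj_AB layer[OF assms(1)]] .

text \<open>The layer bounds are added over the colours. With \<open>card \<tau> = l + m\<close> and
  \<open>card \<sigma> = d + 1\<close> for \<open>m\<close> colours this gives
  \<open>d + l + 1\<close>, the number of vertices of a full-dimensional simplex.\<close>

lemma card_coloured_staircase_le:
  assumes "S \<in> coloured_staircases f g c \<tau> \<sigma>"
  shows "card S + card U \<le> card \<tau> + card \<sigma>"
proof -
  have "(\<Sum>u\<in>U. card {z\<in>S. c (snd z) = u} + 1) \<le> (\<Sum>u\<in>U. card (A u) + card (B u))"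
    by (rule sum_mono) (rule card_layer_le[OF assms])
  then show ?thesis
    unfolding sum.distrib card_layers[OF assms] card_\<sigma> card_\<tau> by simp
qed

text \<open>A simplex is determined by its layers, and maximal cardinality forces every layer to be
  a maximal path; so the simplices embed into a product of path sets.\<close>

lemma card_full_coloured_staircases_le:
  shows "real (card {S \<in> coloured_staircases f g c \<tau> \<sigma>. card S + card U = card \<tau> + card \<sigma>})
       \<le> (\<Prod>u\<in>U. multichoose (card (B u)) (card (A u) - 1))" (is "real (card ?F) \<le> _")
proof -
  define \<Phi> where "\<Phi> = (\<lambda>S::('a \<times> 'c) set. \<lambda>u\<in>U. {z\<in>S. c (snd z) = u})"
  let ?G = "\<Pi>\<^sub>E u\<in>U. staircase_paths f g (A u) (B u)"
  have full: "card {z\<in>S. c (snd z) = u} + 1 = card (A u) + card (B u)"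
    if S: "S \<in> ?F" and u: "u \<in> U" for S u
  proof (rule ccontr)
    assume "card {z\<in>S. c (snd z) = u} + 1 \<noteq> card (A u) + card (B u)"
    then have "card {z\<in>S. c (snd z) = u} + 1 < card (A u) + card (B u)"
      using card_layer_le[of S u] S u by simp
    then have "(\<Sum>u\<in>U. card {z\<in>S. c (snd z) = u} + 1) < (\<Sum>u\<in>U. card (A u) + card (B u))"
      using S u fin(3) card_layer_le[of S] by (intro sum_strict_mono_ex1) auto
    then show False using S card_layers[of S] unfolding sum.distrib card_\<sigma> card_\<tau> by simp
  qed
  have "\<Phi> ` ?F \<subseteq> ?G"
  proof (rule image_subsetI)
    fix S assume S: "S \<in> ?F"
    then have "S \<in> coloured_staircases f g c \<tau> \<sigma>" by simp
    then have "{z\<in>S. c (snd z) = u} \<in> staircase_paths f g (A u) (B u)" if "u \<in> U" for u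
      using layer full[OF S that] unfolding staircase_paths_def by blast
    then show "\<Phi> S \<in> ?G" unfolding \<Phi>_def by (rule restrict_PiE_iff[THEN iffD2, rule_format])
  qed
  moreover have "inj_on \<Phi> ?F"
  proof (rule inj_onI)
    fix S S' assume S: "S \<in> ?F" "S' \<in> ?F" and eq: "\<Phi> S = \<Phi> S'"
    have layers: "S = (\<Union>u\<in>U. \<Phi> S u)" if "S \<in> ?F" for S
      using that col(1) unfolding \<Phi>_def coloured_staircases_def by fastforce
    show "S = S'" using layers[OF S(1)] layers[OF S(2)] eq by simp
  qed
  moreover have finG: "finite ?G"
    using fin(3) fin_AB by (intro finite_PiE finite_staircase_paths) auto
  ultimately have "card ?F \<le> card ?G" by (intro card_inj_on_le)
  then have "real (card ?F) \<le> real (\<Prod>u\<in>U. card (staircase_paths f g (A u) (B u)))"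
    unfolding card_PiE[OF fin(3)] by (rule of_nat_mono)
  also have "\<dots> \<le> (\<Prod>u\<in>U. multichoose (card (B u)) (card (A u) - 1))"
    unfolding of_nat_prod
    using card_staircase_paths_le[OF fin_AB fibre inj_AB] by (intro prod_mono) auto
  finally show ?thesis .
qed

end

section \<open>Averaging over all colourings\<close>

lemma sum_recolour:
  fixes F :: "('c \<Rightarrow> 'b) \<Rightarrow> real"
  assumes fin: "finite W" "finite U" and w: "w \<in> W" and u: "u \<in> U"
  shows "(\<Sum>c\<in>W \<rightarrow>\<^sub>E U. F (c(w := u))) = card U * (\<Sum>c\<in>{c \<in> W \<rightarrow>\<^sub>E U. c w = u}. F c)"
proof -
  let ?X = "W \<rightarrow>\<^sub>E U" and ?Y = "{c \<in> W \<rightarrow>\<^sub>E U. c w = u}"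
  have finX: "finite ?X" using fin by (intro finite_PiE) auto
  have "(\<Sum>c\<in>?X. F (c(w := u))) = (\<Sum>d\<in>?Y. \<Sum>c\<in>{c\<in>?X. c(w := u) = d}. F (c(w := u)))"
  proof (rule sum.group[symmetric, OF finX])
    show "finite ?Y" using finX by simp
    show "(\<lambda>c. c(w := u)) ` ?X \<subseteq> ?Y"
      using w u by (auto simp: PiE_def extensional_def)
  qed
  also have "\<dots> = (\<Sum>d\<in>?Y. card U * F d)"
  proof (rule sum.cong[OF refl])
    fix d assume d: "d \<in> ?Y"
    \<comment> \<open>The colourings that become \<open>d\<close> after recolouring \<open>w\<close>
      differ from \<open>d\<close> at most at \<open>w\<close>, and there is one for each colour
      there.\<close>
    have "{c\<in>?X. c(w := u) = d} = (\<lambda>u'. d(w := u')) ` U"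
    proof (intro equalityI subsetI)
      fix c assume c: "c \<in> {c\<in>?X. c(w := u) = d}"
      then have "c = d(w := c w)" by auto
      moreover have "c w \<in> U" using c w by auto
      ultimately show "c \<in> (\<lambda>u'. d(w := u')) ` U" by blast
    next
      fix c assume "c \<in> (\<lambda>u'. d(w := u')) ` U"
      then show "c \<in> {c\<in>?X. c(w := u) = d}"
        using d w by (auto simp: PiE_def extensional_def)
    qed
    moreover have "inj_on (\<lambda>u'. d(w := u')) U" by (rule inj_onI) (metis fun_upd_same)
    ultimately have "card {c\<in>?X. c(w := u) = d} = card U" by (simp add: card_image)
    then show "(\<Sum>c\<in>{c\<in>?X. c(w := u) = d}. F (c(w := u))) = card U * F d" by simp
  qed
  finally show ?thesis by (simp add: sum_distrib_left)
qed

lemma pochhammer_mono: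
  fixes x y :: real
  assumes "0 \<le> x" "x \<le> y"
  shows "pochhammer x t \<le> pochhammer y t"
  unfolding pochhammer_prod using assms by (intro prod_mono) auto

text \<open>
  The average of the rising factorials over all colourings is estimated one factor at a time: a
  factor \<open>k\<^sub>u + b\<^sub>u\<close> counts \<open>b\<^sub>u\<close> fixed objects and the vertices of colour \<open>u\<close>, each of
  which has colour \<open>u\<close> for one colouring in \<open>card U\<close>; once its colour is prescribed, it
  shifts the remaining \<open>k\<^sub>u\<close> by at most \<open>1\<close>.
\<close>

lemma sum_colourings_pochhammer_le:
  fixes W :: "'c set" and b t :: "'b \<Rightarrow> nat"
  assumes fin: "finite W" "finite U" and U: "U \<noteq> {}" and \<sigma>: "\<sigma> \<subseteq> W"
  shows "(\<Sum>c\<in>W \<rightarrow>\<^sub>E U. \<Prod>u\<in>U. pochhammer (real (card {w\<in>\<sigma>. c w = u} + b u)) (t u))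
       \<le> card U ^ card W * (\<Prod>u\<in>U. \<Prod>j<t u. card \<sigma> / card U + b u + 2 * real j)"
proof (induction "\<Sum>u\<in>U. t u" arbitrary: b t rule: less_induct)
  case less
  have fin\<sigma>: "finite \<sigma>" using \<sigma> fin(1) finite_subset by blast
  let ?X = "W \<rightarrow>\<^sub>E U"
  have finX: "finite ?X" using fin by (intro finite_PiE) auto
  show ?case
  proof (cases "\<forall>u\<in>U. t u = 0")
    case True
    then show ?thesis using fin(1) by (simp add: card_PiE)
  next
    case False
    then obtain u where u: "u \<in> U" "t u \<noteq> 0" by blast
    then obtain s where s: "t u = Suc s" using not0_implies_Suc by blast
    define t' where "t' = t(u := s)"
    have tU: "(\<Sum>u\<in>U. t' u) < (\<Sum>u\<in>U. t u)"
      using fin(2) u s by (intro sum_strict_mono_ex1) (auto simp: t'_def)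
    define k where "k = (\<lambda>(c :: 'c \<Rightarrow> 'b) u. card {w\<in>\<sigma>. c w = u})"
    \<comment> \<open>\<open>H e\<close> is the product of the remaining factors with the count of
      colour \<open>u\<close> shifted by \<open>e\<close> more: shift 1 is what splitting off the
      first factor leaves, shift 2 allows for one prescribed vertex.\<close>
    define H where "H = (\<lambda>e c. \<Prod>v\<in>U. pochhammer (real (k c v + (b(u := b u + e)) v)) (t' v))"
    have H_nonneg: "0 \<le> H e c" for e c
      unfolding H_def pochhammer_prod by (intro prod_nonneg) auto
    have split: "(\<Prod>v\<in>U. pochhammer (real (k c v + b v)) (t v)) = (real (k c u) + b u) * H 1 c" for c
    proof -
      have "(\<Prod>v\<in>U - {u}. pochhammer (real (k c v + b v)) (t v))
          = (\<Prod>v\<in>U - {u}. pochhammer (real (k c v + (b(u := b u + 1)) v)) (t' v))"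
        by (rule prod.cong) (auto simp: t'_def)
      moreover have "pochhammer (real (k c u + b u)) (t u)
          = (real (k c u) + b u) * pochhammer (real (k c u + (b(u := b u + 1)) u)) (t' u)"
        using s by (simp add: t'_def pochhammer_rec algebra_simps)
      ultimately show ?thesis
        unfolding H_def using fin(2) u(1) by (simp add: prod.remove[of U u] add_ac)
    qed
    have H_mono: "H d c \<le> H e c'" if "\<And>v. k c v + (b(u := b u + d)) v \<le> k c' v + (b(u := b u + e)) v"
      for c c' d e
      unfolding H_def
    proof (intro prod_mono conjI)
      fix v
      show "0 \<le> pochhammer (real (k c v + (b(u := b u + d)) v)) (t' v)"
        unfolding pochhammer_prod by (intro prod_nonneg) auto
      show "pochhammer (real (k c v + (b(u := b u + d)) v)) (t' v)
          \<le> pochhammer (real (k c' v + (b(u := b u + e)) v)) (t' v)"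
        using that[of v] by (intro pochhammer_mono) linarith+
    qed
    \<comment> \<open>Recolouring \<open>w\<close> raises the count of colour \<open>u\<close> by at
      most 1, which the second shift absorbs, and raises no other count.\<close>
    have prescribed: "(\<Sum>c\<in>{c\<in>?X. c w = u}. H 1 c) \<le> (\<Sum>c\<in>?X. H 2 c) / card U" if w: "w \<in> \<sigma>" for w
    proof -
      have "H 1 (c(w := u)) \<le> H 2 c" for c
      proof (rule H_mono)
        fix v
        have "k (c(w := u)) v \<le> k c v + (if v = u then 1 else 0)"
        proof (cases "v = u")
          case True
          have "{x\<in>\<sigma>. (c(w := u)) x = v} \<subseteq> insert w {x\<in>\<sigma>. c x = v}" by auto
          then have "k (c(w := u)) v \<le> card (insert w {x\<in>\<sigma>. c x = v})"
            unfolding k_def using fin\<sigma> by (intro card_mono) auto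
          also have "\<dots> \<le> Suc (k c v)" unfolding k_def by (rule card_insert_le_m1) simp_all
          finally show ?thesis using True by simp
        next
          case False
          then show ?thesis unfolding k_def using fin\<sigma> by (auto intro!: card_mono)
        qed
        then show "k (c(w := u)) v + (b(u := b u + 1)) v \<le> k c v + (b(u := b u + 2)) v"
          by (auto split: if_splits)
      qed
      then have "(\<Sum>c\<in>?X. H 1 (c(w := u))) \<le> (\<Sum>c\<in>?X. H 2 c)" by (rule sum_mono)
      then have "card U * (\<Sum>c\<in>{c\<in>?X. c w = u}. H 1 c) \<le> (\<Sum>c\<in>?X. H 2 c)"
        using sum_recolour[OF fin _ u(1), of w "H 1"] w \<sigma> by auto
      moreover have "card U > 0" using fin(2) U by (simp add: card_gt_0_iff)
      ultimately show ?thesis by (simp add: pos_le_divide_eq mult.commute)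
    qed
    \<comment> \<open>The count of colour \<open>u\<close> is written as a sum over the vertices of
      \<sigma>, and the colour of each of them is prescribed in turn.\<close>
    have "(\<Sum>c\<in>?X. real (k c u) * H 1 c) = (\<Sum>c\<in>?X. \<Sum>w\<in>\<sigma>. if c w = u then H 1 c else 0)"
      using fin\<sigma> by (simp add: k_def sum.If_cases Int_def)
    also have "\<dots> = (\<Sum>w\<in>\<sigma>. \<Sum>c\<in>?X. if c w = u then H 1 c else 0)" by (rule sum.swap)
    also have "\<dots> = (\<Sum>w\<in>\<sigma>. \<Sum>c\<in>{c\<in>?X. c w = u}. H 1 c)"
      by (rule sum.cong[OF refl]) (rule sum.inter_filter[OF finX, symmetric])
    also have "\<dots> \<le> (\<Sum>w\<in>\<sigma>. (\<Sum>c\<in>?X. H 2 c) / card U)" by (rule sum_mono) (rule prescribed)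
    finally have 1: "(\<Sum>c\<in>?X. real (k c u) * H 1 c) \<le> card \<sigma> / card U * (\<Sum>c\<in>?X. H 2 c)" by simp
    have 2: "(\<Sum>c\<in>?X. H 1 c) \<le> (\<Sum>c\<in>?X. H 2 c)"
      by (intro sum_mono H_mono) auto
    have "(\<Sum>c\<in>?X. \<Prod>v\<in>U. pochhammer (real (k c v + b v)) (t v))
        = (\<Sum>c\<in>?X. real (k c u) * H 1 c) + b u * (\<Sum>c\<in>?X. H 1 c)"
      by (simp only: split distrib_right sum.distrib sum_distrib_left)
    also have "\<dots> \<le> (card \<sigma> / card U + b u) * (\<Sum>c\<in>?X. H 2 c)"
      using 1 mult_left_mono[OF 2, of "real (b u)"] by (simp add: distrib_right)
    also have "\<dots> \<le> (card \<sigma> / card U + b u) * (card U ^ card W *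
        (\<Prod>v\<in>U. \<Prod>j<t' v. card \<sigma> / card U + (b(u := b u + 2)) v + 2 * real j))"
      unfolding H_def k_def by (intro mult_left_mono less.hyps tU) auto
    also have "\<dots> = card U ^ card W * ((card \<sigma> / card U + b u) *
        (\<Prod>v\<in>U. \<Prod>j<t' v. card \<sigma> / card U + (b(u := b u + 2)) v + 2 * real j))"
      by simp
    also have "(card \<sigma> / card U + b u) *
        (\<Prod>v\<in>U. \<Prod>j<t' v. card \<sigma> / card U + (b(u := b u + 2)) v + 2 * real j)
        = (\<Prod>v\<in>U. \<Prod>j<t v. card \<sigma> / card U + b v + 2 * real j)"
    proof -
      have "(\<Prod>v\<in>U - {u}. \<Prod>j<t' v. card \<sigma> / card U + (b(u := b u + 2)) v + 2 * real j)
          = (\<Prod>v\<in>U - {u}. \<Prod>j<t v. card \<sigma> / card U + b v + 2 * real j)"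
        by (rule prod.cong) (auto simp: t'_def)
      \<comment> \<open>Shift 2 is why the factors advance in steps of 2: with
        \<open>b u + 2\<close>, factor \<open>j\<close> is the old factor
        \<open>j + 1\<close>.\<close>
      moreover have "(card \<sigma> / card U + b u) *
          (\<Prod>j<t' u. card \<sigma> / card U + (b(u := b u + 2)) u + 2 * real j)
          = (\<Prod>j<t u. card \<sigma> / card U + b u + 2 * real j)"
        unfolding s t'_def prod.lessThan_Suc_shift by (simp add: algebra_simps)
      ultimately show ?thesis
        using fin(2) u(1) by (simp add: prod.remove[of U u] mult.assoc[symmetric])
    qed
    finally show ?thesis by (simp add: k_def)
  qed
qed

text \<open>For \<open>t > 0\<close> the mean of the factors is \<open>x + t - 1\<close>, so this is
  weaker than the inequality of the means; Bernoulli's inequality gives the induction step.\<close>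

lemma prod_arith_le_power:
  fixes x :: real
  assumes "0 \<le> x"
  shows "(\<Prod>j<t. x + 2 * real j) \<le> (x + real t) ^ t"
proof (induction t)
  case (Suc t)
  define y where "y = x + real t"
  have y: "0 \<le> y" using assms by (simp add: y_def)
  have "(\<Prod>j<Suc t. x + 2 * real j) = (\<Prod>j<t. x + 2 * real j) * (y + t)"
    by (simp add: y_def)
  also have "\<dots> \<le> y ^ t * (y + t)"
    using Suc y by (intro mult_right_mono) (auto simp: y_def)
  also have "\<dots> \<le> (y + 1) ^ Suc t"
  proof (cases "y = 0")
    case False
    then have y: "0 < y" using y by simp
    have "y ^ t * (y + t) \<le> y ^ Suc t * (1 + real (Suc t) * (1 / y))"
      using y by (simp add: field_simps)
    also have "\<dots> \<le> y ^ Suc t * (1 + 1 / y) ^ Suc t"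
    proof (rule mult_left_mono)
      have "0 \<le> 1 / y" using y by simp
      then have "-1 \<le> 1 / y" by linarith
      then show "1 + real (Suc t) * (1 / y) \<le> (1 + 1 / y) ^ Suc t"
        by (rule Bernoulli_inequality)
    qed (use y in simp)
    also have "\<dots> = (y * (1 + 1 / y)) ^ Suc t" by (rule power_mult_distrib[symmetric])
    also have "y * (1 + 1 / y) = y + 1" using y by (simp add: field_simps)
    finally show ?thesis .
  qed (cases t; simp)
  also have "y + 1 = x + real (Suc t)" by (simp add: y_def)
  finally show ?case .
qed simp

lemma sum_colourings_multichoose_le:
  assumes fin: "finite W" "finite U" and U: "U \<noteq> {}" and \<sigma>: "\<sigma> \<subseteq> W"
    and l: "(\<Sum>u\<in>U. t u) = l"
  shows "(\<Sum>c\<in>W \<rightarrow>\<^sub>E U. \<Prod>u\<in>U. multichoose (card {w\<in>\<sigma>. c w = u}) (t u))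
       \<le> card U ^ card W * ((card \<sigma> / card U + l) ^ l / (\<Prod>u\<in>U. fact (t u)))"
proof -
  let ?x = "card \<sigma> / card U"
  let ?f = "\<Prod>u\<in>U. fact (t u) :: real"
  have "(\<Prod>u\<in>U. \<Prod>j<t u. ?x + 2 * real j) \<le> (\<Prod>u\<in>U. (?x + l) ^ t u)"
  proof (intro prod_mono conjI)
    fix u assume u: "u \<in> U"
    show "0 \<le> (\<Prod>j<t u. ?x + 2 * real j)" by (intro prod_nonneg) auto
    have "(\<Prod>j<t u. ?x + 2 * real j) \<le> (?x + t u) ^ t u" by (rule prod_arith_le_power) simp
    also have "t u \<le> l" unfolding l[symmetric] using fin(2) u by (intro member_le_sum) auto
    then have "(?x + t u) ^ t u \<le> (?x + l) ^ t u" by (intro power_mono) auto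
    finally show "(\<Prod>j<t u. ?x + 2 * real j) \<le> (?x + l) ^ t u" .
  qed
  also have "\<dots> = (?x + l) ^ l" by (simp only: power_sum[symmetric] l)
  finally have le: "(\<Prod>u\<in>U. \<Prod>j<t u. ?x + 2 * real j) \<le> (?x + l) ^ l" .
  have "(\<Sum>c\<in>W \<rightarrow>\<^sub>E U. \<Prod>u\<in>U. multichoose (card {w\<in>\<sigma>. c w = u}) (t u))
      = (\<Sum>c\<in>W \<rightarrow>\<^sub>E U. \<Prod>u\<in>U. pochhammer (real (card {w\<in>\<sigma>. c w = u} + 0)) (t u)) / ?f"
    by (simp add: multichoose_def prod_dividef sum_divide_distrib)
  also have "\<dots> \<le> card U ^ card W * (?x + l) ^ l / ?f"
  proof (rule divide_right_mono)
    have "(\<Sum>c\<in>W \<rightarrow>\<^sub>E U. \<Prod>u\<in>U. pochhammer (real (card {w\<in>\<sigma>. c w = u} + 0)) (t u))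
        \<le> card U ^ card W * (\<Prod>u\<in>U. \<Prod>j<t u. ?x + real 0 + 2 * real j)"
      by (rule sum_colourings_pochhammer_le[OF fin U \<sigma>, of "\<lambda>_. 0"])
    also have "\<dots> \<le> card U ^ card W * (?x + l) ^ l"
      using le by (intro mult_left_mono) auto
    finally show "(\<Sum>c\<in>W \<rightarrow>\<^sub>E U. \<Prod>u\<in>U. pochhammer (real (card {w\<in>\<sigma>. c w = u} + 0)) (t u))
        \<le> card U ^ card W * (?x + l) ^ l" .
    show "0 \<le> ?f" by (intro prod_nonneg) auto
  qed
  finally show ?thesis by simp
qed

text \<open>One colouring has to serve all pairs at once, so the total over all pairs is averaged:
  not every colouring can exceed the bound for the mean.\<close>

lemma exists_good_colouring:
  assumes fin: "finite W" "finite U" "finite TQ" "finite T0" and U: "U \<noteq> {}"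
    and TQ: "\<And>\<sigma>. \<sigma> \<in> TQ \<Longrightarrow> \<sigma> \<subseteq> W \<and> card \<sigma> = n"
    and l: "\<And>\<tau>. \<tau> \<in> T0 \<Longrightarrow> (\<Sum>u\<in>U. t \<tau> u) = l"
  shows "\<exists>c\<in>W \<rightarrow>\<^sub>E U. (\<Sum>\<sigma>\<in>TQ. \<Sum>\<tau>\<in>T0. \<Prod>u\<in>U. multichoose (card {w\<in>\<sigma>. c w = u}) (t \<tau> u))
       \<le> card TQ * (n / card U + l) ^ l * (\<Sum>\<tau>\<in>T0. 1 / (\<Prod>u\<in>U. fact (t \<tau> u)))"
proof (rule ccontr)
  let ?X = "W \<rightarrow>\<^sub>E U"
  let ?F = "\<lambda>c. \<Sum>\<sigma>\<in>TQ. \<Sum>\<tau>\<in>T0. \<Prod>u\<in>U. multichoose (card {w\<in>\<sigma>. c w = u}) (t \<tau> u)"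
  let ?M = "card TQ * (n / card U + l) ^ l * (\<Sum>\<tau>\<in>T0. 1 / (\<Prod>u\<in>U. fact (t \<tau> u)))"
  assume neg: "\<not> (\<exists>c\<in>?X. ?F c \<le> ?M)"
  have "?X \<noteq> {}" using U by (simp add: PiE_eq_empty_iff)
  moreover have "finite ?X" using fin by (intro finite_PiE) auto
  ultimately have "(\<Sum>c\<in>?X. ?M) < (\<Sum>c\<in>?X. ?F c)"
    using neg by (intro sum_strict_mono) auto
  also have "(\<Sum>c\<in>?X. ?F c) = (\<Sum>\<sigma>\<in>TQ. \<Sum>c\<in>?X. \<Sum>\<tau>\<in>T0. \<Prod>u\<in>U. multichoose (card {w\<in>\<sigma>. c w = u}) (t \<tau> u))"
    by (rule sum.swap)
  also have "\<dots> = (\<Sum>\<sigma>\<in>TQ. \<Sum>\<tau>\<in>T0. \<Sum>c\<in>?X. \<Prod>u\<in>U. multichoose (card {w\<in>\<sigma>. c w = u}) (t \<tau> u))"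
    by (rule sum.cong[OF refl]) (rule sum.swap)
  also have "\<dots> \<le> (\<Sum>\<sigma>\<in>TQ. \<Sum>\<tau>\<in>T0. card U ^ card W * ((n / card U + l) ^ l / (\<Prod>u\<in>U. fact (t \<tau> u))))"
  proof (intro sum_mono)
    fix \<sigma> \<tau> assume "\<sigma> \<in> TQ" "\<tau> \<in> T0"
    then show "(\<Sum>c\<in>?X. \<Prod>u\<in>U. multichoose (card {w\<in>\<sigma>. c w = u}) (t \<tau> u))
        \<le> card U ^ card W * ((n / card U + l) ^ l / (\<Prod>u\<in>U. fact (t \<tau> u)))"
      using sum_colourings_multichoose_le[OF fin(1,2) U, of \<sigma> "t \<tau>" l] TQ l by auto
  qed
  also have "\<dots> = (\<Sum>c\<in>?X. ?M)"
    using fin(1) by (simp add: card_PiE sum_distrib_left ac_simps)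
  finally show False by simp
qed

section \<open>Triangulations of cubes\<close>

lemma lookup_scaleR:
  "Poly_Mapping.lookup (r *\<^sub>R x) i = r *\<^sub>R Poly_Mapping.lookup x i"
proof -
  have "finite {i. r *\<^sub>R Poly_Mapping.lookup x i \<noteq> 0}"
    by (rule finite_subset[OF _ finite_lookup[of x]]) auto
  then show ?thesis by (simp add: scaleR_poly_mapping_def)
qed

lemma convex_unit_cube: "convex (unit_cube d)"
  unfolding convex_alt
proof (intro ballI allI impI)
  fix x y and t :: real
  assume x: "x \<in> unit_cube d" and y: "y \<in> unit_cube d" and t: "0 \<le> t \<and> t \<le> 1"
  have "0 \<le> (1 - t) * a + t * b \<and> (1 - t) * a + t * b \<le> 1"
    if "0 \<le> a" "a \<le> 1" "0 \<le> b" "b \<le> 1" for a b :: real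
    using that t convex_bound_le[of a 1 b "1 - t" t] by auto
  then show "(1 - t) *\<^sub>R x + t *\<^sub>R y \<in> unit_cube d"
    using x y by (auto simp: unit_cube_def lookup_add lookup_scaleR)
qed

abbreviation unit_vec :: "nat \<Rightarrow> nat \<Rightarrow>\<^sub>0 real" where
  "unit_vec i \<equiv> Poly_Mapping.single i 1"

lemma inj_unit_vec: "inj unit_vec"
  by (rule injI) (metis lookup_single_eq lookup_single_not_eq zero_neq_one)

lemma unit_cube_eq_sum:
  assumes "x \<in> unit_cube d"
  shows "x = (\<Sum>i<d. Poly_Mapping.lookup x i *\<^sub>R unit_vec i)"
proof (rule poly_mapping_eqI)
  fix j
  have "Poly_Mapping.lookup (\<Sum>i<d. Poly_Mapping.lookup x i *\<^sub>R unit_vec i) j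
      = (\<Sum>i<d. if i = j then Poly_Mapping.lookup x i else 0)"
    unfolding lookup_sum
    by (rule sum.cong[OF refl]) (simp add: lookup_scaleR lookup_single when_def)
  also have "\<dots> = Poly_Mapping.lookup x j"
    using assms by (auto simp: unit_cube_def)
  finally show "Poly_Mapping.lookup x j
      = Poly_Mapping.lookup (\<Sum>i<d. Poly_Mapping.lookup x i *\<^sub>R unit_vec i) j" by simp
qed

lemma independent_unit_vecs: "independent (unit_vec ` {..<d})"
proof
  assume "dependent (unit_vec ` {..<d})"
  then obtain u i where u: "i < d" "u (unit_vec i) \<noteq> 0" "(\<Sum>x\<in>unit_vec ` {..<d}. u x *\<^sub>R x) = 0"
    by (auto simp: dependent_finite)
  have "(\<Sum>j<d. u (unit_vec j) *\<^sub>R unit_vec j) = 0"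
    using u(3) sum.reindex[OF inj_on_subset[OF inj_unit_vec], of "{..<d}" "\<lambda>x. u x *\<^sub>R x"] by simp
  then have "Poly_Mapping.lookup (\<Sum>j<d. u (unit_vec j) *\<^sub>R unit_vec j) i = 0" by simp
  moreover have "Poly_Mapping.lookup (\<Sum>j<d. u (unit_vec j) *\<^sub>R unit_vec j) i
      = (\<Sum>j<d. if j = i then u (unit_vec j) else 0)"
    unfolding lookup_sum
    by (rule sum.cong[OF refl]) (simp add: lookup_scaleR lookup_single when_def)
  ultimately show False using u(1,2) by simp
qed

lemma unit_vec_nonzero: "unit_vec i \<noteq> 0"
  by (metis lookup_single_eq lookup_zero zero_neq_one)

lemma unit_cube_frame:
  defines "B \<equiv> \<lambda>d. insert 0 (unit_vec ` {..<d})"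
  shows "B d \<subseteq> unit_cube d" "\<not> affine_dependent (B d)" "card (B d) = d + 1"
proof -
  show "B d \<subseteq> unit_cube d"
    by (auto simp: B_def unit_cube_def lookup_single when_def)
  have 0: "0 \<notin> unit_vec ` {..<d}" using unit_vec_nonzero by (metis imageE)
  show "\<not> affine_dependent (B d)"
    unfolding B_def affine_dependent_iff_dependent[OF 0] using independent_unit_vecs by simp
  show "card (B d) = d + 1"
    using 0 card_image[OF inj_on_subset[OF inj_unit_vec], of "{..<d}"] by (simp add: B_def)
qed

text \<open>A simplex without a vertex over \<open>u\<close> would lie in the cube times the facet
  opposite to \<open>u\<close>, whose affine hull is generated by at most
  \<open>l + card U - 1\<close> points, one too few.\<close>

lemma triangulation_meets_every_vertex_fibre:
  fixes U :: "'b::real_vector set"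
  assumes T0: "triangulates (l + card U - 1) T0 (unit_cube l \<times> (convex hull U))"
    and fin: "finite U" and u: "u \<in> U" and \<tau>: "\<tau> \<in> T0"
  shows "{p. (p, u) \<in> \<tau>} \<noteq> {}"
proof
  assume empty: "{p. (p, u) \<in> \<tau>} = {}"
  have U0: "card U > 0" using u fin by (auto simp: card_gt_0_iff)
  have card: "card \<tau> = l + card U" using T0 \<tau> U0 by (simp add: triangulates_def)
  have sub: "p \<in> unit_cube l \<and> u' \<in> U - {u}" if pu: "(p, u') \<in> \<tau>" for p u'
  proof -
    have "(p, u') extreme_point_of (unit_cube l \<times> (convex hull U))"
      using T0 \<tau> pu by (auto simp: triangulates_def)
    from extreme_point_of_TimesD[OF this] have "p \<in> unit_cube l" "u' \<in> U"
      using extreme_point_of_convex_hull by (auto simp: extreme_point_of_def)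
    then show ?thesis using empty pu by auto
  qed
  show False
  proof (cases "U - {u} = {}")
    case True
    then have "\<tau> = {}" using sub by auto
    then show False using card U0 by simp
  next
    case False
    then obtain u0 where u0: "u0 \<in> U - {u}" by blast
    \<comment> \<open>\<open>W\<close> consists of \<open>(0, u0)\<close>, one step from it in each
      of the \<open>l\<close> coordinate directions, and the other vertices of the facet over
      0.\<close>
    define W where "W = (\<lambda>i. (unit_vec i, u0)) ` {..<l} \<union> Pair 0 ` (U - {u})"
    have finW: "finite W" using fin by (simp add: W_def)
    have hull: "affine hull W = (\<lambda>x. (0, u0) + x) ` span ((\<lambda>x. - (0, u0) + x) ` W)"
      using affine_hull_insert_span_gen[of "(0, u0)" W] u0 by (simp add: W_def insert_absorb)
    have "\<tau> \<subseteq> affine hull W"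
    proof (rule subrelI)
      fix p u' assume "(p, u') \<in> \<tau>"
      then have p: "p \<in> unit_cube l" and u': "u' \<in> U - {u}" using sub by auto
      let ?D = "(\<lambda>x. - (0, u0) + x) ` W"
      have "(unit_vec i, 0) \<in> ?D" if "i < l" for i
        by (rule image_eqI[of _ _ "(unit_vec i, u0)"]) (use that in \<open>auto simp: W_def\<close>)
      then have "(\<Sum>i<l. Poly_Mapping.lookup p i *\<^sub>R (unit_vec i, 0)) \<in> span ?D"
        by (intro span_sum span_scale span_base) auto
      moreover have "(0, u' - u0) \<in> span ?D"
        by (rule span_base, rule image_eqI[of _ _ "(0, u')"]) (use u' in \<open>auto simp: W_def\<close>)
      moreover have "(\<Sum>i<l. Poly_Mapping.lookup p i *\<^sub>R (unit_vec i, 0 :: 'b)) = (p, 0)"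
        using unit_cube_eq_sum[OF p] by (simp add: sum_prod)
      ultimately have "(p, 0) + (0, u' - u0) \<in> span ?D" using span_add by metis
      then have "(0, u0) + (p, u' - u0) \<in> affine hull W" unfolding hull by (intro imageI) simp
      then show "(p, u') \<in> affine hull W" by simp
    qed
    then have "card \<tau> \<le> card W"
      using card_le_affine_hull[of \<tau> W] finW T0 \<tau> by (auto simp: triangulates_def)
    also have "\<dots> \<le> card {..<l} + card (U - {u})"
      unfolding W_def using card_Un_le card_image_le fin
      by (intro order_trans[OF card_Un_le] add_mono card_image_le) auto
    also have "\<dots> < l + card U" using card_Diff1_less[OF fin u] by simp
    finally show False using card by simp
  qed
qed

text \<open>The coordinates of the second vector are moved past the first \<open>l\<close>. Adding
  the first vector unchanged keeps the map linear on the whole space; it is a true concatenation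
  when the first vector vanishes from coordinate \<open>l\<close> on.\<close>

definition concat_vec :: "nat \<Rightarrow> (nat \<Rightarrow>\<^sub>0 real) \<times> (nat \<Rightarrow>\<^sub>0 real) \<Rightarrow> (nat \<Rightarrow>\<^sub>0 real)" where
  "concat_vec l z = fst z + Abs_poly_mapping (\<lambda>i. if i < l then 0 else Poly_Mapping.lookup (snd z) (i - l))"

lemma lookup_concat_vec:
  "Poly_Mapping.lookup (concat_vec l z) i
     = Poly_Mapping.lookup (fst z) i + (if i < l then 0 else Poly_Mapping.lookup (snd z) (i - l))"
proof -
  have "{i. (if i < l then 0 else Poly_Mapping.lookup (snd z) (i - l)) \<noteq> 0}
      \<subseteq> (\<lambda>i. i + l) ` {i. Poly_Mapping.lookup (snd z) i \<noteq> 0}"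
    by (force split: if_splits)
  then have "finite {i. (if i < l then 0 else Poly_Mapping.lookup (snd z) (i - l)) \<noteq> 0}"
    using finite_lookup[of "snd z"] by (meson finite_imageI finite_subset)
  then show ?thesis by (simp add: concat_vec_def lookup_add)
qed

lemma linear_concat_vec: "linear (concat_vec l)"
proof (rule linearI)
  show "concat_vec l (x + y) = concat_vec l x + concat_vec l y" for x y
    by (rule poly_mapping_eqI) (simp add: lookup_concat_vec lookup_add)
  show "concat_vec l (r *\<^sub>R x) = r *\<^sub>R concat_vec l x" for r x
    by (rule poly_mapping_eqI) (simp add: lookup_concat_vec lookup_scaleR distrib_left)
qed

lemma inj_on_concat_vec: "inj_on (concat_vec l) (unit_cube l \<times> unit_cube d)"
proof (rule inj_onI)
  fix x y assume x: "x \<in> unit_cube l \<times> unit_cube d" and y: "y \<in> unit_cube l \<times> unit_cube d"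
    and eq: "concat_vec l x = concat_vec l y"
  have eq': "Poly_Mapping.lookup (fst x) i + (if i < l then 0 else Poly_Mapping.lookup (snd x) (i - l))
      = Poly_Mapping.lookup (fst y) i + (if i < l then 0 else Poly_Mapping.lookup (snd y) (i - l))" for i
    using lookup_concat_vec[of l x i] lookup_concat_vec[of l y i] eq by simp
  have "Poly_Mapping.lookup (fst x) i = Poly_Mapping.lookup (fst y) i" for i
    using x y eq'[of i] by (cases "i < l") (auto simp: unit_cube_def)
  moreover from this have "Poly_Mapping.lookup (snd x) i = Poly_Mapping.lookup (snd y) i" for i
    using eq'[of "i + l"] by simp
  ultimately show "x = y" by (simp add: prod_eq_iff poly_mapping_eqI)
qed

lemma concat_vec_image: "concat_vec l ` (unit_cube l \<times> unit_cube d) = unit_cube (d + l)"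
proof (intro equalityI subsetI)
  fix x assume "x \<in> concat_vec l ` (unit_cube l \<times> unit_cube d)"
  then show "x \<in> unit_cube (d + l)"
    by (auto simp: unit_cube_def lookup_concat_vec)
next
  fix x assume x: "x \<in> unit_cube (d + l)"
  define p where "p = Abs_poly_mapping (\<lambda>i. if i < l then Poly_Mapping.lookup x i else 0)"
  define q where "q = Abs_poly_mapping (\<lambda>i. Poly_Mapping.lookup x (i + l))"
  have "finite {i. (if i < l then Poly_Mapping.lookup x i else 0) \<noteq> 0}"
    by (rule finite_subset[of _ "{..<l}"]) (auto split: if_splits)
  then have p: "Poly_Mapping.lookup p i = (if i < l then Poly_Mapping.lookup x i else 0)" for i
    by (simp add: p_def)
  have "finite {i. Poly_Mapping.lookup x (i + l) \<noteq> 0}"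
    by (rule finite_subset[of _ "{..<d}"])
      (use x in \<open>auto simp: unit_cube_def intro: ccontr\<close>)
  then have q: "Poly_Mapping.lookup q i = Poly_Mapping.lookup x (i + l)" for i
    by (simp add: q_def)
  have "p \<in> unit_cube l" "q \<in> unit_cube d" using x by (auto simp: unit_cube_def p q)
  moreover have "x = concat_vec l (p, q)"
    by (rule poly_mapping_eqI) (simp add: lookup_concat_vec p q)
  ultimately show "x \<in> concat_vec l ` (unit_cube l \<times> unit_cube d)" by blast
qed

text \<open>\<open>T\<close> consists of the full-dimensional simplices of the product complex for a
  good colouring, carried over to the cube of dimension \<open>d + l\<close>. Each lies over some
  pair from \<open>TQ\<close> and \<open>T0\<close> with the maximal cardinality there, so the
  counts over the pairs bound its size.\<close>

lemma exists_cube_triangulation_from_product: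
  fixes U :: "'b::real_vector set"
  assumes U: "finite U" "U \<noteq> {}" "\<not> affine_dependent U"
    and T0: "triangulates (l + card U - 1) T0 (unit_cube l \<times> (convex hull U))"
    and TQ: "triangulates d TQ (unit_cube d)"
  shows "\<exists>T. triangulates (d + l) T (unit_cube (d + l)) \<and>
    card T \<le> card TQ * (Suc d / card U + l) ^ l *
             (\<Sum>\<tau>\<in>T0. 1 / (\<Prod>u\<in>U. fact (card {p. (p, u) \<in> \<tau>} - 1)))"
proof -
  let ?W = "\<Union>TQ"
  let ?V = "fst ` \<Union>T0"
  let ?t = "\<lambda>\<tau> u. card {p. (p, u) \<in> \<tau>} - 1"
  have coverQ: "simplicial_cover TQ (unit_cube d)"
    using triangulates_imp_simplicial_cover[OF TQ] .
  have cover0: "simplicial_cover T0 (unit_cube l \<times> (convex hull U))"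
    using triangulates_imp_simplicial_cover[OF T0] .
  have finW: "finite ?W" using simplicial_coverD(1,2)[OF coverQ] by auto
  have finV: "finite ?V" using simplicial_coverD(1,2)[OF cover0] by auto
  obtain f :: "(nat \<Rightarrow>\<^sub>0 real) \<Rightarrow> nat" where f: "inj_on f ?V"
    using finite_imp_inj_to_nat_seg[OF finV] by blast
  obtain g :: "(nat \<Rightarrow>\<^sub>0 real) \<Rightarrow> nat" where g: "inj_on g ?W"
    using finite_imp_inj_to_nat_seg[OF finW] by blast
  have U0: "card U > 0" using U by (simp add: card_gt_0_iff)
  have card\<tau>: "card \<tau> = l + card U" if "\<tau> \<in> T0" for \<tau>
    using T0 that U0 by (simp add: triangulates_def)
  have card\<sigma>: "card \<sigma> = Suc d" if "\<sigma> \<in> TQ" for \<sigma>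
    using TQ that by (simp add: triangulates_def)
  have sndU: "snd ` \<tau> \<subseteq> U" if \<tau>: "\<tau> \<in> T0" for \<tau>
  proof (intro image_subsetI)
    fix z assume "z \<in> \<tau>"
    then have "(fst z, snd z) extreme_point_of (unit_cube l \<times> (convex hull U))"
      using simplicial_coverD(3)[OF cover0 \<tau>] by auto
    then show "snd z \<in> U"
      using extreme_point_of_TimesD(2) extreme_point_of_convex_hull by blast
  qed
  have pair: "coloured_pair f g c U \<tau> \<sigma>"
    if "\<sigma> \<in> TQ" "\<tau> \<in> T0" "c \<in> ?W \<rightarrow>\<^sub>E U" for c \<sigma> \<tau>
  proof
    show "finite \<tau>" using simplicial_coverD(2)[OF cover0 that(2)] .
    show "finite \<sigma>" using simplicial_coverD(2)[OF coverQ that(1)] .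
    show "finite U" by fact
    show "inj_on f (fst ` \<tau>)" by (rule inj_on_subset[OF f]) (use that(2) in blast)
    show "inj_on g \<sigma>" by (rule inj_on_subset[OF g]) (use that(1) in blast)
    show "c ` \<sigma> \<subseteq> U" using that(1,3) by (auto simp: PiE_def Pi_def)
    show "snd ` \<tau> \<subseteq> U" using sndU[OF that(2)] .
    show "{p. (p, u) \<in> \<tau>} \<noteq> {}" if "u \<in> U" for u
      using triangulation_meets_every_vertex_fibre[OF T0 U(1) that \<open>\<tau> \<in> T0\<close>] .
  qed
  have sum_t: "(\<Sum>u\<in>U. ?t \<tau> u) = l" if \<tau>: "\<tau> \<in> T0" for \<tau>
  proof -
    have fin\<tau>: "finite \<tau>" using simplicial_coverD(2)[OF cover0 \<tau>] .
    have "(\<Sum>u\<in>U. card {p. (p, u) \<in> \<tau>}) = card \<tau>"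
      unfolding card_fibre using sum.group[OF fin\<tau> U(1) sndU[OF \<tau>], of "\<lambda>_. 1::nat"] by simp
    moreover have "card {p. (p, u) \<in> \<tau>} = ?t \<tau> u + 1" if u: "u \<in> U" for u
    proof -
      have "{p. (p, u) \<in> \<tau>} \<subseteq> fst ` \<tau>" by force
      then have "finite {p. (p, u) \<in> \<tau>}" using fin\<tau> finite_subset by blast
      then have "card {p. (p, u) \<in> \<tau>} > 0"
        using triangulation_meets_every_vertex_fibre[OF T0 U(1) u \<tau>] by (simp add: card_gt_0_iff)
      then show ?thesis by simp
    qed
    ultimately have "(\<Sum>u\<in>U. ?t \<tau> u + 1) = card \<tau>" by simp
    then show ?thesis using card\<tau>[OF \<tau>] by (simp only: sum.distrib) simp
  qed
  have "\<exists>c\<in>?W \<rightarrow>\<^sub>E U. (\<Sum>\<sigma>\<in>TQ. \<Sum>\<tau>\<in>T0. \<Prod>u\<in>U. multichoose (card {w\<in>\<sigma>. c w = u}) (?t \<tau> u))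
       \<le> card TQ * (Suc d / card U + l) ^ l * (\<Sum>\<tau>\<in>T0. 1 / (\<Prod>u\<in>U. fact (?t \<tau> u)))"
    using finW U simplicial_coverD(1)[OF coverQ] simplicial_coverD(1)[OF cover0] card\<sigma> sum_t
    by (intro exists_good_colouring) auto
  then obtain c where c: "c \<in> ?W \<rightarrow>\<^sub>E U"
    and good: "(\<Sum>\<sigma>\<in>TQ. \<Sum>\<tau>\<in>T0. \<Prod>u\<in>U. multichoose (card {w\<in>\<sigma>. c w = u}) (?t \<tau> u))
       \<le> card TQ * (Suc d / card U + l) ^ l * (\<Sum>\<tau>\<in>T0. 1 / (\<Prod>u\<in>U. fact (?t \<tau> u)))" by blast
  interpret coloured_product "unit_cube l" "unit_cube d" U T0 TQ c f g
    by unfold_locales (use convex_unit_cube U cover0 coverQ c f g in \<open>auto simp: PiE_def Pi_def\<close>)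
  let ?K = "(`) (concat_vec l) ` product_complex"
  have X: "convex (unit_cube l \<times> unit_cube d)" by (intro convex_Times convex_unit_cube)
  have coverK: "simplicial_cover ?K (unit_cube (d + l))"
    using simplicial_cover_linear_image[OF simplicial_cover_product_complex X
        linear_concat_vec inj_on_concat_vec] concat_vec_image by metis
  have card_image: "card (concat_vec l ` S) = card S" if "S \<in> product_complex" for S
  proof (rule card_image)
    have "S \<subseteq> unit_cube l \<times> unit_cube d"
      using simplicial_coverD(3)[OF simplicial_cover_product_complex that]
      by (auto simp: extreme_point_of_def)
    then show "inj_on (concat_vec l) S" by (rule inj_on_subset[OF inj_on_concat_vec])
  qed
  have card_le: "card S \<le> d + l + 1" if S: "S \<in> product_complex" for S
  proof -
    obtain \<sigma> \<tau> where \<sigma>\<tau>: "\<sigma> \<in> TQ" "\<tau> \<in> T0" "S \<in> coloured_staircases f g c \<tau> \<sigma>"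
      using S unfolding product_complex_def by blast
    interpret coloured_pair f g c U \<tau> \<sigma> using pair[OF \<sigma>\<tau>(1,2) c] .
    show ?thesis
      using card_coloured_staircase_le[OF \<sigma>\<tau>(3)] card\<sigma>[OF \<sigma>\<tau>(1)] card\<tau>[OF \<sigma>\<tau>(2)] by simp
  qed
  let ?T = "{S\<in>?K. card S = d + l + 1}"
  have tri: "triangulates (d + l) ?T (unit_cube (d + l))"
    by (rule simplicial_cover_full_dimensional_triangulates[OF coverK convex_unit_cube
          unit_cube_frame(1) unit_cube_frame(2) unit_cube_frame(3)])
      (use card_le card_image in auto)
  let ?F = "{S\<in>product_complex. card S = d + l + 1}"
  let ?G = "\<lambda>\<sigma> \<tau>. {S\<in>coloured_staircases f g c \<tau> \<sigma>. card S + card U = card \<tau> + card \<sigma>}"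
  have finF: "finite ?F" using simplicial_coverD(1)[OF simplicial_cover_product_complex] by simp
  have finG: "finite (?G \<sigma> \<tau>)" if "\<sigma> \<in> TQ" "\<tau> \<in> T0" for \<sigma> \<tau>
  proof (rule finite_subset)
    show "?G \<sigma> \<tau> \<subseteq> product_complex" using that unfolding product_complex_def by blast
  qed (rule simplicial_coverD(1)[OF simplicial_cover_product_complex])
  have "?T \<subseteq> (`) (concat_vec l) ` ?F"
  proof
    fix S assume "S \<in> ?T"
    then obtain R where R: "R \<in> product_complex" "S = concat_vec l ` R" "card S = d + l + 1" by blast
    then have "R \<in> ?F" using card_image[OF R(1)] by simp
    then show "S \<in> (`) (concat_vec l) ` ?F" using R(2) by (rule image_eqI[rotated])
  qed
  then have "card ?T \<le> card ?F" by (rule surj_card_le[OF finF])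
  \<comment> \<open>An upper bound is the aim, so a simplex lying over several pairs may be counted
    several times.\<close>
  also have "?F \<subseteq> (\<Union>\<sigma>\<in>TQ. \<Union>\<tau>\<in>T0. ?G \<sigma> \<tau>)"
  proof
    fix S assume S: "S \<in> ?F"
    then obtain \<sigma> \<tau> where \<sigma>\<tau>: "\<sigma> \<in> TQ" "\<tau> \<in> T0" "S \<in> coloured_staircases f g c \<tau> \<sigma>"
      unfolding product_complex_def by blast
    then have "S \<in> ?G \<sigma> \<tau>" using S card\<sigma>[OF \<sigma>\<tau>(1)] card\<tau>[OF \<sigma>\<tau>(2)] by simp
    then show "S \<in> (\<Union>\<sigma>\<in>TQ. \<Union>\<tau>\<in>T0. ?G \<sigma> \<tau>)" using \<sigma>\<tau> by blast
  qed
  then have "card ?F \<le> card (\<Union>\<sigma>\<in>TQ. \<Union>\<tau>\<in>T0. ?G \<sigma> \<tau>)"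
    using finG simplicial_coverD(1)[OF coverQ] simplicial_coverD(1)[OF cover0]
    by (intro card_mono finite_UN_I) auto
  also have "\<dots> \<le> (\<Sum>\<sigma>\<in>TQ. card (\<Union>\<tau>\<in>T0. ?G \<sigma> \<tau>))"
    using simplicial_coverD(1)[OF coverQ] by (rule card_UN_le)
  also have "\<dots> \<le> (\<Sum>\<sigma>\<in>TQ. \<Sum>\<tau>\<in>T0. card (?G \<sigma> \<tau>))"
    by (intro sum_mono card_UN_le simplicial_coverD(1)[OF cover0])
  finally have "real (card ?T) \<le> real (\<Sum>\<sigma>\<in>TQ. \<Sum>\<tau>\<in>T0. card (?G \<sigma> \<tau>))" by (rule of_nat_mono)
  also have "\<dots> \<le> (\<Sum>\<sigma>\<in>TQ. \<Sum>\<tau>\<in>T0. \<Prod>u\<in>U. multichoose (card {w\<in>\<sigma>. c w = u}) (?t \<tau> u))"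
    unfolding of_nat_sum
    by (intro sum_mono) (rule coloured_pair.card_full_coloured_staircases_le[OF pair[OF _ _ c]])
  also note good
  finally show ?thesis using tri by blast
qed

section \<open>The asymptotic inequality and the limit\<close>

lemma triangulates_unit_interval: "triangulates 1 {{0, unit_vec 0}} (unit_cube 1)"
proof -
  have ext0: "(0 :: nat \<Rightarrow>\<^sub>0 real) extreme_point_of (unit_cube 1)"
    unfolding extreme_point_of_def
  proof (intro conjI ballI notI)
    show "0 \<in> unit_cube 1" by (simp add: unit_cube_def)
    fix a b assume ab: "a \<in> unit_cube 1" "b \<in> unit_cube 1" "0 \<in> open_segment a b"
    then obtain t where t: "0 < t" "t < 1" "0 = (1 - t) *\<^sub>R a + t *\<^sub>R b" "a \<noteq> b"
      by (auto simp: in_segment)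
    have "Poly_Mapping.lookup a i = Poly_Mapping.lookup b i" for i
    proof (cases "i = 0")
      case True
      have "0 = (1 - t) * Poly_Mapping.lookup a 0 + t * Poly_Mapping.lookup b 0"
        using arg_cong[OF t(3), of "\<lambda>x. Poly_Mapping.lookup x 0"]
        by (simp add: lookup_add lookup_scaleR)
      moreover have "0 \<le> Poly_Mapping.lookup a 0" "0 \<le> Poly_Mapping.lookup b 0"
        using ab by (auto simp: unit_cube_def)
      ultimately have "Poly_Mapping.lookup a 0 = 0" "Poly_Mapping.lookup b 0 = 0"
        using t(1,2) by (auto simp: eq_commute[of 0] add_nonneg_eq_0_iff)
      then show ?thesis using True by simp
    next
      case False
      then show ?thesis using ab by (auto simp: unit_cube_def)
    qed
    then show False using t(4) poly_mapping_eqI by blast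
  qed
  have ext1: "unit_vec 0 extreme_point_of (unit_cube 1)"
    unfolding extreme_point_of_def
  proof (intro conjI ballI notI)
    show "unit_vec 0 \<in> unit_cube 1" using unit_cube_frame(1)[of 1] by (simp add: lessThan_Suc)
    fix a b assume ab: "a \<in> unit_cube 1" "b \<in> unit_cube 1" "unit_vec 0 \<in> open_segment a b"
    then obtain t where t: "0 < t" "t < 1" "unit_vec 0 = (1 - t) *\<^sub>R a + t *\<^sub>R b" "a \<noteq> b"
      by (auto simp: in_segment)
    have "Poly_Mapping.lookup a i = Poly_Mapping.lookup b i" for i
    proof (cases "i = 0")
      case True
      have "1 = (1 - t) * Poly_Mapping.lookup a 0 + t * Poly_Mapping.lookup b 0"
        using arg_cong[OF t(3), of "\<lambda>x. Poly_Mapping.lookup x 0"]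
        by (simp add: lookup_add lookup_scaleR)
      then have "(1 - t) * (1 - Poly_Mapping.lookup a 0) + t * (1 - Poly_Mapping.lookup b 0) = 0"
        by (simp add: algebra_simps)
      moreover have "0 \<le> 1 - Poly_Mapping.lookup a 0" "0 \<le> 1 - Poly_Mapping.lookup b 0"
        using ab by (auto simp: unit_cube_def)
      ultimately have "1 - Poly_Mapping.lookup a 0 = 0" "1 - Poly_Mapping.lookup b 0 = 0"
        using t(1,2) by (auto simp: add_nonneg_eq_0_iff)
      then show ?thesis using True by simp
    next
      case False
      then show ?thesis using ab by (auto simp: unit_cube_def)
    qed
    then show False using t(4) poly_mapping_eqI by blast
  qed
  have "convex hull {0, unit_vec 0} = unit_cube 1"
  proof
    have "{0, unit_vec 0} \<subseteq> unit_cube 1" using ext0 ext1 by (simp add: extreme_point_of_def)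
    then show "convex hull {0, unit_vec 0} \<subseteq> unit_cube 1"
      using convex_unit_cube hull_minimal by blast
    show "unit_cube 1 \<subseteq> convex hull {0, unit_vec 0}"
    proof
      fix x assume x: "x \<in> unit_cube 1"
      let ?a = "Poly_Mapping.lookup x 0"
      have "x = (1 - ?a) *\<^sub>R 0 + ?a *\<^sub>R unit_vec 0" using unit_cube_eq_sum[OF x] by simp
      moreover have "0 \<le> 1 - ?a" "0 \<le> ?a" "1 - ?a + ?a = 1" using x by (auto simp: unit_cube_def)
      ultimately show "x \<in> convex hull {0, unit_vec 0}" unfolding convex_hull_2 by blast
    qed
  qed
  moreover have "\<not> affine_dependent {0, unit_vec 0}" "card {0, unit_vec 0} = 2"
    using unit_cube_frame[of 1] by (simp_all add: lessThan_Suc)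
  ultimately show ?thesis
    unfolding triangulates_def using ext0 ext1 face_of_refl[OF convex_unit_cube[of 1]] by simp
qed

lemma triangulates_unit_cube_Times_singleton:
  assumes "triangulates d T (unit_cube d)"
  shows "triangulates d ((`) (\<lambda>p. (p, 0::'b::real_vector)) ` T) (unit_cube d \<times> (convex hull {0}))"
proof -
  have "linear (\<lambda>p. (p, 0::'b))" by (rule linearI) auto
  moreover have "(\<lambda>p. (p, 0::'b)) ` unit_cube d = unit_cube d \<times> (convex hull {0})" by auto
  ultimately show ?thesis
    using triangulates_linear_image[OF assms convex_unit_cube, of "\<lambda>p. (p, 0::'b)"]
    by (auto simp: inj_on_def)
qed

lemma triangulates_unit_cube_0: "triangulates 0 {{0}} (unit_cube 0)"
proof -
  have "unit_cube 0 = {0}"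
    by (auto simp: unit_cube_def intro: poly_mapping_eqI)
  then show ?thesis
    by (simp add: triangulates_def extreme_point_of_def face_of_refl)
qed

text \<open>The product construction with a unit interval and a one-point simplex raises the
  dimension by one. Hence \<open>cube_phi\<close> is a minimum over a nonempty set.\<close>

lemma exists_triangulation_unit_cube: "\<exists>T. triangulates d T (unit_cube d)"
proof (induction d)
  case 0
  show ?case using triangulates_unit_cube_0 by blast
next
  case (Suc d)
  then obtain TQ where "triangulates d TQ (unit_cube d)" by blast
  then show ?case
    using exists_cube_triangulation_from_product[of "{0::real}" 1 "(`) (\<lambda>p. (p, 0)) ` {{0, unit_vec 0}}" d TQ]
      triangulates_unit_cube_Times_singleton[OF triangulates_unit_interval, where 'b = real] by auto
qed

section \<open>Minimal sizes and the recursion for their normalisation\<close>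

lemma exists_minimal_triangulation:
  obtains T where "triangulates d T (unit_cube d)" "card T = cube_phi d"
proof -
  have "\<exists>k T. triangulates d T (unit_cube d) \<and> card T = k"
    using exists_triangulation_unit_cube by blast
  from LeastI_ex[OF this] show thesis using that unfolding cube_phi_def by blast
qed

lemma cube_phi_le: "triangulates d T (unit_cube d) \<Longrightarrow> cube_phi d \<le> card T"
  unfolding cube_phi_def by (rule Least_le) blast

lemma cube_rho_nonneg: "0 \<le> cube_rho d"
  unfolding cube_rho_def by (intro real_root_ge_zero) simp

lemma cube_rho_power: "d \<ge> 1 \<Longrightarrow> cube_rho d ^ d = cube_phi d / fact d"
  by (simp add: cube_rho_def)

lemma cube_phi_0: "cube_phi 0 \<le> 1"
  using cube_phi_le[OF triangulates_unit_cube_0] by simp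

text \<open>Equality holds for \<open>d \<ge> 1\<close>; for \<open>d = 0\<close> the right-hand
  side is 1 by the convention on powers, and one simplex triangulates the point.\<close>

lemma cube_phi_le_cube_rho_power: "cube_phi d / fact d \<le> cube_rho d ^ d"
  using cube_rho_power[of d] cube_phi_0 by (cases "d = 0") auto

lemma fact_mult_power_le: "fact d * Suc d ^ l \<le> (fact (d + l) :: nat)"
proof (induction l)
  case (Suc l)
  have "fact d * Suc d ^ Suc l = Suc d * (fact d * Suc d ^ l)" by (simp only: power_Suc ac_simps)
  also have "\<dots> \<le> Suc (d + l) * fact (d + l)" using Suc by (intro mult_mono) auto
  finally show ?case by (simp only: add_Suc_right fact_Suc of_nat_id)
qed simp

lemma sum_weight_nonneg: "0 \<le> (\<Sum>\<tau>\<in>T. weight m v \<tau>)"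
  by (auto intro!: sum_nonneg prod_nonneg simp: weight_def)

lemma weighted_efficiency_nonneg: "0 \<le> weighted_efficiency l m v T"
  unfolding weighted_efficiency_def
  by (intro real_root_ge_zero divide_nonneg_nonneg sum_weight_nonneg) simp

text \<open>The claimed inequality with \<open>n = d + 1\<close> and the explicit error
  \<open>l m \<rho> / n\<close> in place of \<epsilon>; in this form it also serves for the passage
  to the limit.\<close>

lemma cube_rho_step_le:
  fixes v :: "nat \<Rightarrow> 'b::real_vector"
  assumes l: "l \<ge> 1" and m: "m \<ge> 1" and inj: "inj_on v {1..m}"
    and indep: "\<not> affine_dependent (v ` {1..m})"
    and T0: "triangulates (l + m - 1) T0 (unit_cube l \<times> (convex hull (v ` {1..m})))"
    and rho: "weighted_efficiency l m v T0 = \<rho>"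
  shows "cube_rho (d + l) ^ (d + l) \<le> cube_rho d ^ d * (\<rho> + l * m * \<rho> / Suc d) ^ l"
proof -
  let ?U = "v ` {1..m}" and ?n = "real (Suc d)"
  have cU: "card ?U = m" using card_image[OF inj] by simp
  have w: "1 / (\<Prod>u\<in>?U. fact (card {p. (p, u) \<in> \<tau>} - 1)) = weight m v \<tau>" for \<tau>
    unfolding weight_def simplex_type_def prod.reindex[OF inj] card_fibre o_def ..
  have \<rho>pow: "\<rho> ^ l = (\<Sum>\<tau>\<in>T0. weight m v \<tau>) / m ^ l"
    unfolding rho[symmetric] weighted_efficiency_def
    using real_root_pow_pos2[of l "(\<Sum>\<tau>\<in>T0. weight m v \<tau>) / m ^ l"] l sum_weight_nonneg[of m v T0]
    by simp
  obtain TQ where TQ: "triangulates d TQ (unit_cube d)" "card TQ = cube_phi d"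
    by (rule exists_minimal_triangulation)
  obtain T where T: "triangulates (d + l) T (unit_cube (d + l))"
    "card T \<le> card TQ * (Suc d / card ?U + l) ^ l *
             (\<Sum>\<tau>\<in>T0. 1 / (\<Prod>u\<in>?U. fact (card {p. (p, u) \<in> \<tau>} - 1)))"
    using exists_cube_triangulation_from_product[of ?U l T0 d TQ] T0 TQ(1) m indep cU by auto
  have "cube_phi (d + l) \<le> card T" using cube_phi_le[OF T(1)] .
  then have "real (cube_phi (d + l)) \<le> cube_phi d * (?n / m + l) ^ l * (\<Sum>\<tau>\<in>T0. weight m v \<tau>)"
    using T(2) unfolding w cU TQ(2) by linarith
  \<comment> \<open>The \<open>m ^ l\<close> of the weighted efficiency is absorbed into the base
    \<open>n / m + l\<close>; pulling out \<open>n\<close> then leaves the base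
    \<open>\<rho> + l m \<rho> / n\<close>.\<close>
  also have "\<dots> = cube_phi d * (((?n / m + l) * m) ^ l * \<rho> ^ l)"
    using m by (simp add: \<rho>pow power_mult_distrib)
  also have "(?n / m + l) * m = ?n + l * m" using m by (simp add: distrib_right del: of_nat_Suc)
  also have "(?n + l * m) ^ l * \<rho> ^ l = (?n * (\<rho> + l * m * \<rho> / ?n)) ^ l"
    unfolding power_mult_distrib[symmetric] by (simp add: distrib_right distrib_left del: of_nat_Suc)
  finally have le: "real (cube_phi (d + l)) \<le> cube_phi d * (?n ^ l * (\<rho> + l * m * \<rho> / ?n) ^ l)"
    by (simp only: power_mult_distrib)
  have \<rho>0: "0 \<le> \<rho>"
    unfolding rho[symmetric] by (rule weighted_efficiency_nonneg)
  then have pos: "0 \<le> (\<rho> + l * m * \<rho> / ?n) ^ l" by simp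
  have "cube_rho (d + l) ^ (d + l) = cube_phi (d + l) / fact (d + l)"
    using l by (intro cube_rho_power) simp
  \<comment> \<open>The power \<open>n ^ l\<close> will cancel: each of the \<open>l\<close>
    additional factors of \<open>fact (d + l)\<close> is at least \<open>n\<close>.\<close>
  also have "\<dots> \<le> cube_phi d * (?n ^ l * (\<rho> + l * m * \<rho> / ?n) ^ l) / (fact d * ?n ^ l)"
  proof (rule frac_le)
    have "real (fact d * Suc d ^ l) \<le> real (fact (d + l))"
      using fact_mult_power_le by (rule of_nat_mono)
    then show "fact d * ?n ^ l \<le> (fact (d + l) :: real)" by simp
    show "0 \<le> cube_phi d * (?n ^ l * (\<rho> + l * m * \<rho> / ?n) ^ l)" using pos by simp
  qed (use le in auto)
  also have "\<dots> = cube_phi d / fact d * (\<rho> + l * m * \<rho> / ?n) ^ l"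
    by simp
  also have "\<dots> \<le> cube_rho d ^ d * (\<rho> + l * m * \<rho> / ?n) ^ l"
    using cube_phi_le_cube_rho_power pos by (rule mult_right_mono)
  finally show ?thesis by (simp only: of_nat_mult)
qed

text \<open>The case \<open>m = 1\<close> with a minimal triangulation of the cube itself: every
  weight is \<open>1 / fact l\<close>, so the weighted efficiency is
  \<open>cube_rho l\<close>.\<close>

lemma cube_rho_step_self_le:
  assumes l: "l \<ge> 1"
  shows "cube_rho (d + l) ^ (d + l) \<le> cube_rho d ^ d * (cube_rho l + l * cube_rho l / Suc d) ^ l"
proof -
  obtain T where T: "triangulates l T (unit_cube l)" "card T = cube_phi l"
    by (rule exists_minimal_triangulation)
  let ?v = "\<lambda>_::nat. 0::real" and ?T = "(`) (\<lambda>p. (p, 0::real)) ` T"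
  have inj: "inj_on ((`) (\<lambda>p. (p, 0::real))) T"
    by (rule inj_onI) (simp add: inj_image_eq_iff inj_def)
  have "weight 1 ?v ((\<lambda>p. (p, 0)) ` \<tau>) = 1 / fact l" if "\<tau> \<in> T" for \<tau>
  proof -
    have "{p \<in> (\<lambda>p. (p, 0::real)) ` \<tau>. snd p = 0} = (\<lambda>p. (p, 0)) ` \<tau>" by auto
    moreover have "card ((\<lambda>p. (p, 0::real)) ` \<tau>) = l + 1"
      using T(1) that card_image[of "\<lambda>p. (p, 0::real)" \<tau>] by (simp add: triangulates_def inj_on_def)
    ultimately show ?thesis by (simp add: weight_def simplex_type_def)
  qed
  then have "(\<Sum>\<tau>\<in>?T. weight 1 ?v \<tau>) = cube_phi l / fact l"
    by (simp add: sum.reindex[OF inj] T(2))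
  then have "weighted_efficiency l 1 ?v ?T = cube_rho l"
    by (simp add: weighted_efficiency_def cube_rho_def)
  moreover have "triangulates (l + 1 - 1) ?T (unit_cube l \<times> (convex hull (?v ` {1..1})))"
    using triangulates_unit_cube_Times_singleton[OF T(1), where 'b = real] by simp
  ultimately show ?thesis
    using cube_rho_step_le[of l 1 ?v ?T "cube_rho l" d] l by simp
qed

text \<open>For \<open>q\<close> between \<open>r\<close> and \<open>s\<close>, every step from a
  large \<open>d\<close> costs at most a factor \<open>q ^ l\<close>; so \<open>a i ^ i\<close> is
  at most a constant times \<open>q ^ i\<close>, which eventually falls below
  \<open>s ^ i\<close>.\<close>

lemma eventually_le_of_power_step:
  fixes a :: "nat \<Rightarrow> real"
  assumes a: "\<And>i. 0 \<le> a i" and l: "l \<ge> 1" and r: "0 \<le> r" "r < s"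
    and step: "\<And>d. a (d + l) ^ (d + l) \<le> a d ^ d * (r + C / Suc d) ^ l" and C: "0 \<le> C"
  shows "eventually (\<lambda>i. a i \<le> s) sequentially"
proof -
  define q where "q = (r + s) / 2"
  have q: "r < q" "q < s" "0 < q" using r by (auto simp: q_def)
  have "(\<lambda>d. r + C / Suc d) \<longlonglongrightarrow> r + 0"
    by (intro tendsto_add tendsto_const LIMSEQ_Suc lim_const_over_n)
  then have "eventually (\<lambda>d. r + C / Suc d < q) sequentially"
    using q(1) by (intro order_tendstoD) auto
  then obtain N where N: "\<And>d. d \<ge> N \<Longrightarrow> r + C / Suc d < q"
    by (auto simp: eventually_sequentially)
  \<comment> \<open>\<open>M\<close> makes the bound hold for all \<open>i < N + l\<close>, which
    supplies a starting point in each residue class modulo \<open>l\<close>; beyond that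
    \<open>d = i - l\<close> is at least \<open>N\<close>.\<close>
  define M where "M = (\<Sum>i<N + l. a i ^ i / q ^ i)"
  have terms: "0 \<le> a i ^ i / q ^ i" for i using a q by simp
  have M: "0 \<le> M" unfolding M_def using terms by (intro sum_nonneg) auto
  have bound: "a i ^ i \<le> M * q ^ i" for i
  proof (induction i rule: less_induct)
    case (less i)
    show ?case
    proof (cases "i < N + l")
      case True
      then have "a i ^ i / q ^ i \<le> M" unfolding M_def
        using terms by (intro member_le_sum) auto
      then show ?thesis using q by (simp add: pos_divide_le_eq)
    next
      case False
      define d where "d = i - l"
      have d: "i = d + l" "N \<le> d" "d < i" using False l by (auto simp: d_def)
      have "a i ^ i \<le> a d ^ d * (r + C / Suc d) ^ l" using step[of d] d(1) by simp
      also have "\<dots> \<le> (M * q ^ d) * q ^ l"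
        using less[OF d(3)] N[OF d(2)] a C r(1) q M
        by (intro mult_mono power_mono) auto
      finally show ?thesis by (simp add: d(1) power_add mult.assoc)
    qed
  qed
  have "(\<lambda>i. (q / s) ^ i * M) \<longlonglongrightarrow> 0 * M"
    using q r by (intro tendsto_mult tendsto_const LIMSEQ_realpow_zero) auto
  then have "eventually (\<lambda>i. (q / s) ^ i * M < 1) sequentially"
    by (intro order_tendstoD) auto
  then show ?thesis
    using eventually_gt_at_top[of 0]
  proof eventually_elim
    case (elim i)
    have s: "0 < s" using q by simp
    have "a i ^ i \<le> M * q ^ i" by (rule bound)
    also have "\<dots> = (q / s) ^ i * M * s ^ i" using s by (simp add: power_divide)
    also have "\<dots> \<le> 1 * s ^ i" using elim s by (intro mult_right_mono) auto
    finally show "a i \<le> s" using elim(2) s a power_mono_iff[of "a i" s i] by simp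
  qed
qed

text \<open>The limit is the infimum over positive dimensions: much as in Fekete's lemma, every
  number above some \<open>cube_rho l\<close> is an eventual upper bound by the step with the cube
  itself.\<close>

lemma convergent_cube_rho: "convergent cube_rho"
proof -
  define L where "L = Inf (cube_rho ` {1..})"
  have bdd: "bdd_below (cube_rho ` {1..})" using cube_rho_nonneg by (intro bdd_belowI) auto
  have "cube_rho \<longlonglongrightarrow> L"
  proof (rule order_tendstoI)
    fix b assume b: "b < L"
    show "eventually (\<lambda>i. b < cube_rho i) sequentially"
      using eventually_ge_at_top[of 1]
    proof eventually_elim
      case (elim i)
      then have "L \<le> cube_rho i" unfolding L_def by (intro cInf_lower bdd) auto
      then show ?case using b by simp
    qed
  next
    fix b assume "L < b"
    then obtain l where l: "l \<ge> 1" "cube_rho l < b"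
      unfolding L_def using cInf_lessD[of "cube_rho ` {1..}" b] by auto
    define s where "s = (cube_rho l + b) / 2"
    have s: "cube_rho l < s" "s < b" using l(2) by (auto simp: s_def)
    have "eventually (\<lambda>i. cube_rho i \<le> s) sequentially"
      by (rule eventually_le_of_power_step[where C = "l * cube_rho l" and l = l and r = "cube_rho l"])
        (use cube_rho_nonneg l(1) s(1) cube_rho_step_self_le in auto)
    then show "eventually (\<lambda>i. cube_rho i < b) sequentially"
      by eventually_elim (use s(2) in simp)
  qed
  then show ?thesis by (rule convergentI)
qed

theorem theorem2p3:
  fixes l m :: nat
    and v :: "nat \<Rightarrow> 'b::real_vector"
    and T0 :: "((nat \<Rightarrow>\<^sub>0 real) \<times> 'b) set set"
    and \<rho>bar :: real
  assumes "l \<ge> 1" and "m \<ge> 1"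
    and "inj_on v {1..m}" and "\<not> affine_dependent (v ` {1..m})"
    and "triangulates (l + m - 1) T0 (unit_cube l \<times> (convex hull (v ` {1..m})))"
    and "weighted_efficiency l m v T0 = \<rho>bar"
  shows "(\<forall>\<epsilon>>0. \<forall>n\<ge>1. real n > real l * real m * \<rho>bar / \<epsilon> \<longrightarrow>
            cube_rho (n + l - 1) ^ (n + l - 1) \<le> cube_rho (n - 1) ^ (n - 1) * (\<rho>bar + \<epsilon>) ^ l)
         \<and> convergent cube_rho \<and> lim cube_rho \<le> \<rho>bar"
proof (intro conjI allI impI)
  note step = cube_rho_step_le[OF assms]
  have \<rho>0: "0 \<le> \<rho>bar" using weighted_efficiency_nonneg assms(6) by metis
  show "cube_rho (n + l - 1) ^ (n + l - 1) \<le> cube_rho (n - 1) ^ (n - 1) * (\<rho>bar + \<epsilon>) ^ l"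
    if \<epsilon>: "0 < \<epsilon>" and n: "1 \<le> n" "real l * real m * \<rho>bar / \<epsilon> < real n" for \<epsilon> n
  proof -
    have nd: "n + l - 1 = n - 1 + l" "Suc (n - 1) = n" using n(1) by auto
    \<comment> \<open>The condition on \<open>n\<close> says that the error term is smaller than
      \<epsilon>; here \<open>n\<close> is the \<open>Suc d\<close> of the recursion with
      \<open>d = n - 1\<close>.\<close>
    have "l * m * \<rho>bar / n \<le> \<epsilon>"
      using n \<epsilon> by (simp add: pos_divide_le_eq pos_divide_less_eq mult.commute)
    then have "(\<rho>bar + l * m * \<rho>bar / n) ^ l \<le> (\<rho>bar + \<epsilon>) ^ l"
      using \<rho>0 by (intro power_mono) auto
    then have "cube_rho (n - 1) ^ (n - 1) * (\<rho>bar + l * m * \<rho>bar / n) ^ l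
        \<le> cube_rho (n - 1) ^ (n - 1) * (\<rho>bar + \<epsilon>) ^ l"
      using cube_rho_nonneg by (intro mult_left_mono) auto
    then show ?thesis using step[of "n - 1"] unfolding nd by simp
  qed
  show "convergent cube_rho" by (rule convergent_cube_rho)
  then have lim: "cube_rho \<longlonglongrightarrow> lim cube_rho" by (simp add: convergent_LIMSEQ_iff)
  show "lim cube_rho \<le> \<rho>bar"
  proof (rule field_le_epsilon)
    fix \<epsilon> :: real assume \<epsilon>: "0 < \<epsilon>"
    have "eventually (\<lambda>i. cube_rho i \<le> \<rho>bar + \<epsilon>) sequentially"
      by (rule eventually_le_of_power_step[where C = "l * m * \<rho>bar" and l = l and r = \<rho>bar])
        (use cube_rho_nonneg assms(1) \<rho>0 \<epsilon> step in auto)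
    then show "lim cube_rho \<le> \<rho>bar + \<epsilon>"
      by (intro tendsto_upperbound[OF lim]) auto
  qed
qed

end
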